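(* Assume that conditions (A1), (A2) and (A3) (stated in the context) hold. Then, as $n\to\infty$, for all $j\in J$ and $l\in\mathbb N$, $$\mathbb E\big\{|X_n/n-a_j|^l\,\big|\,|X_n-na_j|\le n\delta_*\big\}=O\big(n^{-l/(2m_j)}\big),$$ and for all $j\in J$, $$d_{\mathrm W}\Big(\mathcal L\big(n^{1/(2m_j)}(X_n/n-a_j)\,\big|\,|X_n-na_j|\le n\delta_*\big),\mathcal L(Y_j)\Big)=O\big(n^{-1/(2m_j)}\big)+O\big(n^{1/(2m_* )-1/(2m_j)}\,\mathbf 1[m_j\ne m_*]\big),$$ where $Y_j$ is a random variable with density proportional to $\exp(c_jx^{2m_j}+b_jx)$, $x\in\mathbb R$, with $$c_j=\frac{A^{(2m_j)}(a_j)}{(2m_j)!},\qquad b_j=B'(a_j)\,\mathbf 1[m_j=m_*].$$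
   Context: Setting. Let $m_*\in\mathbb N=\{1,2,\dots\}$ and, for each $n$, let $A_n,B_n:\{0,1/n,\dots,1\}\to\mathbb R$. Put $\sigma_{*,n}=n^{-1+1/(2m_* )}$, $H_n(k/n)=nA_n(k/n)+n\sigma_{*,n}B_n(k/n)$, $Z_n=\sum_{k=0}^n\exp(H_n(k/n))$, and let $X_n$ be the random variable with $\mathbb P[X_n=k]=Z_n^{-1}\exp(H_n(k/n))$, $0\le k\le n$. Let $\varepsilon_*,\delta_*,C_*>0$ be constants, let $(a_j,m_j)_{j\in J}$ be a finite collection of pairs with $a_j\in(0,1)$, $m_j\in\mathbb N$, and let $A,B:[0,1]\to\mathbb R$ with $A\in C^{2m_*+1}([0,1])$, $B\in C^2([0,1])$. (A1) $(a_j)_{j\in J}$ are all the maximizers of $A$, and $\max_{j\in J}m_j=m_*$. For all $j\in J$: $A'(a_j)=\dots=A^{(2m_j-1)}(a_j)=0$ and $\max_{|x-a_j|\le\delta_*}A^{(2m_j)}(x)<0$. The intervals $(a_j-\delta_*,a_j+\delta_* )$, $j\in J$, are disjoint and contained in $(0,1)$. (A2) For $n$ large enough and all $k$ with $|k/n-a_j|\ge\delta_*$ for all $j\in J$: $A_n(k/n)\le\max_{x\in[0,1]}A(x)-\varepsilon_*$ and $|B_n(k/n)|\le C_*$. (A3) For $n$ large enough and all $k,\ell$ for which there is $j\in J$ with $|k/n-a_j|,|\ell/n-a_j|<\delta_*$: $|A_n(k/n)-A(k/n)|\le C_*\frac{\log n}{n}$, $|B_n(k/n)-B(k/n)|\le\frac{C_*}{n}$,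 and $\big|[A_n(k/n)-A_n(\ell/n)]-[A(k/n)-A(\ell/n)]\big|\le\frac{C_*|k-\ell|}{n^2}$. $d_{\mathrm W}$ is the Wasserstein distance $d_{\mathrm W}(X,Y)=\sup_{\|h'\|_\infty\le1}|\mathbb Eh(X)-\mathbb Eh(Y)|$ (it depends only on the laws), and $\mathcal L(\cdot\mid\cdot)$ denotes a conditional law. The constants in $O(\cdot)$ do not depend on $n$. *)

theory Defs
  imports "HOL-Probability.Probability" "HOL-Library.Landau_Symbols"
begin

text \<open>
  The derivative of order \<open>i\<close> of \<open>f\<close> relative to \<open>S\<close>. On \<open>S = {0..1}\<close> it is the usual derivative at
  interior points and the one-sided one at the end points, so that values of \<open>f\<close> outside \<open>S\<close> are
  irrelevant.
\<close>

definition nth_deriv_within :: "real set \<Rightarrow> nat \<Rightarrow> (real \<Rightarrow> real) \<Rightarrow> real \<Rightarrow> real" where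
  "nth_deriv_within S i f = ((\<lambda>g x. vector_derivative g (at x within S)) ^^ i) f"

definition Ck_on :: "nat \<Rightarrow> real set \<Rightarrow> (real \<Rightarrow> real) \<Rightarrow> bool" where
  "Ck_on k S f \<longleftrightarrow>
     (\<forall>i<k. nth_deriv_within S i f differentiable_on S) \<and> continuous_on S (nth_deriv_within S k f)"

definition sigma_star :: "nat \<Rightarrow> nat \<Rightarrow> real" where
  "sigma_star ms n = real n powr (- 1 + 1 / (2 * real ms))"

text \<open>In the following two definitions \<open>F\<close> and \<open>G\<close> play the roles of \<open>A\<^sub>n\<close> and \<open>B\<^sub>n\<close>.\<close>

definition hamiltonian :: "nat \<Rightarrow> (real \<Rightarrow> real) \<Rightarrow> (real \<Rightarrow> real) \<Rightarrow> nat \<Rightarrow> nat \<Rightarrow> real" where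
  "hamiltonian ms F G n k =
     real n * F (real k / real n) + real n * sigma_star ms n * G (real k / real n)"

definition partition_fun :: "nat \<Rightarrow> (real \<Rightarrow> real) \<Rightarrow> (real \<Rightarrow> real) \<Rightarrow> nat \<Rightarrow> real" where
  "partition_fun ms F G n = (\<Sum>k=0..n. exp (hamiltonian ms F G n k))"

text \<open>
  The functions \<open>h\<close> with \<open>\<parallel>h'\<parallel>\<^sub>\<infinity> \<le> 1\<close>: \<open>h\<close> is the integral of a function \<open>h'\<close> (its almost everywhere
  derivative) that is essentially bounded by 1. In particular every everywhere differentiable \<open>h\<close>
  with \<open>\<bar>h'\<bar> \<le> 1\<close> qualifies; altogether these are the 1-Lipschitz functions.
\<close>

definition wasserstein_tests :: "(real \<Rightarrow> real) set" where
  "wasserstein_tests =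
     {h. \<exists>h'. (\<forall>x y. x \<le> y \<longrightarrow> (h' has_integral (h y - h x)) {x..y}) \<and> (AE x in lborel. \<bar>h' x\<bar> \<le> 1)}"

text \<open>
  Meant for probability measures with finite first moment, for which all the integrals exist. The
  supremum is taken in \<^typ>\<open>ennreal\<close>, so it is meaningful without a boundedness proof.
\<close>

definition wasserstein :: "real measure \<Rightarrow> real measure \<Rightarrow> ennreal" where
  "wasserstein P Q =
     (SUP h\<in>wasserstein_tests. ennreal \<bar>(\<integral>x. h x \<partial>P) - (\<integral>x. h x \<partial>Q)\<bar>)"

definition cond_law :: "'a measure \<Rightarrow> 'a set \<Rightarrow> ('a \<Rightarrow> real) \<Rightarrow> real measure" where
  "cond_law M E X = distr (uniform_measure M E) borel X"

end

theory Submission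
  imports Defs "HOL-Real_Asymp.Real_Asymp"
begin

text \<open>
  Fix \<open>j\<close> and write \<open>q = n powr (1 / (2 m))\<close>. In the coordinate \<open>x = q (k / n - a)\<close> the conditioned law
  puts mass proportional to \<open>exp (H k - H k\<^sub>0)\<close>, \<open>k\<^sub>0 = \<lfloor>n a\<rfloor>\<close>, on a grid of mesh \<open>q / n \<le> 1 / q\<close>. Since
  \<open>q ^ (2 m) = n\<close>, Taylor's formula turns \<open>H k - H k\<^sub>0\<close> into \<open>c x ^ (2 m) + b x\<close> up to a polynomial in \<open>\<bar>x\<bar>\<close>
  times the claimed rate. Sums over the grid are integrals of step functions, so no Riemann sum
  argument is needed: the step weight is compared pointwise with \<open>exp (c x ^ (2 m) + b x)\<close> under the
  integrable envelope \<open>(1 + \<bar>x\<bar>) ^ p exp (- 2 \<bar>x\<bar>)\<close>. Outside the window \<open>\<bar>x\<bar>\<close> is at least of order \<open>q\<close>, and one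
  power of \<open>\<bar>x\<bar> / q\<close> pays for the rate; grid points on the boundary of the window are governed by (A2)
  instead of (A3) and have exponentially small weight.
\<close>

text \<open>Why the reference point is k0 and not a: (A3) gives the values A_n(k/n) only up to order
  log n / n, which is unbounded after multiplication by n, whereas it gives their differences up to
  |k - l| / n^2. So the weights must be normalised at a grid point. Moving from a to k0/n is
  harmless: since A'(a) = 0 it changes the exponent by n O(n^-2) through A, and by at most O(1/q)
  through B. The logarithmic bound enters only on the boundary of the window, where it competes with
  -eps n. Inside the window two estimates of the exponent are needed. The expansion has an error of
  order |x|^(2m+1) / q, which is comparable with x^(2m) once |x| is of order q, so it yields the
  rate but no decay. Decay comes from the sign of the derivative of order 2m on the whole window.
  The two are combined through |exp u - exp v| \<le> |u - v| exp w, with w an upper bound of both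
  exponents.\<close>

section \<open>Test functions, grid sums as integrals, elementary inequalities\<close>

lemma wasserstein_tests_lipschitz:
  assumes "h \<in> wasserstein_tests"
  shows "\<bar>h x - h y\<bar> \<le> \<bar>x - y\<bar>"
proof -
  obtain h' where int: "\<And>x y. x \<le> y \<Longrightarrow> (h' has_integral (h y - h x)) {x..y}"
    and ae: "AE x in lborel. \<bar>h' x\<bar> \<le> 1"
    using assms by (auto simp: wasserstein_tests_def)
  \<comment> \<open>\<open>has_integral_bound_real\<close> asks for a bound at every point, while
    \<open>h'\<close> is bounded only almost everywhere. Resetting it to 0 on the exceptional null
    set changes no integral.\<close>
  define g where "g x = (if \<bar>h' x\<bar> \<le> 1 then h' x else 0)" for x
  have "(g has_integral (h y - h x)) {x..y}" if "x \<le> y" for x y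
  proof -
    have "AE t in lborel. t \<in> {x..y} \<longrightarrow> h' t = g t"
      using ae by eventually_elim (simp add: g_def)
    from has_integral_AE[OF this] int[OF that] show ?thesis by simp
  qed
  then have *: "\<bar>h y - h x\<bar> \<le> y - x" if "x \<le> y" for x y
    using has_integral_bound_real[of 1 "{}" g "h y - h x" x y] that by (auto simp: g_def)
  show ?thesis
    using *[of x y] *[of y x] by (cases "x \<le> y") auto
qed

lemma lborel_integrable_inverse_1_plus_square: "integrable lborel (\<lambda>x::real. inverse (1 + x\<^sup>2))"
  using integrable_inverse_1_plus_square
  by (simp add: set_integrable_def einterval_def)

lemma power_times_exp_bounded:
  fixes p :: nat
  shows "\<exists>D\<ge>0. \<forall>x::real. x \<ge> 0 \<longrightarrow> x ^ p * exp (- x) \<le> D"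
proof (intro exI conjI allI impI)
  fix x :: real assume "x \<ge> 0"
  \<comment> \<open>A single term of the exponential series; it provides the witness
    \<open>fact p\<close>.\<close>
  have "x ^ p / fact p \<le> exp x"
    using exp_converges[of x] \<open>x \<ge> 0\<close> sum_le_suminf[of "\<lambda>n. x ^ n /\<^sub>R fact n" "{p}"]
    by (auto simp: sums_iff divide_inverse mult.commute)
  then show "x ^ p * exp (- x) \<le> fact p" by (simp add: exp_minus field_simps)
qed simp

text \<open>Domination by a multiple of 1 / (1 + x^2): multiplying by 1 + x^2 costs two more powers
  of 1 + |x|, which the exponential absorbs. The factor \<open>exp 1\<close> comes from shifting |x|
  to 1 + |x| in the exponent.\<close>

lemma integrable_one_plus_abs_power_times_exp:
  fixes p :: nat
  shows "integrable lborel (\<lambda>x::real. (1 + \<bar>x\<bar>) ^ p * exp (- 2 * \<bar>x\<bar>))"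
proof -
  obtain D where D: "\<And>x::real. x \<ge> 0 \<Longrightarrow> x ^ (p + 2) * exp (- x) \<le> D"
    using power_times_exp_bounded by blast
  have "(1 + \<bar>x\<bar>) ^ p * exp (- 2 * \<bar>x\<bar>) \<le> D * exp 1 * inverse (1 + x\<^sup>2)" for x :: real
  proof -
    have "1 + x\<^sup>2 \<le> (1 + \<bar>x\<bar>)\<^sup>2" by (simp add: power2_sum)
    then have "(1 + \<bar>x\<bar>) ^ p * exp (- 2 * \<bar>x\<bar>) * (1 + x\<^sup>2) \<le> (1 + \<bar>x\<bar>) ^ p * exp (- \<bar>x\<bar>) * (1 + \<bar>x\<bar>)\<^sup>2"
      by (intro mult_mono) auto
    also have "\<dots> = (1 + \<bar>x\<bar>) ^ (p + 2) * exp (- (1 + \<bar>x\<bar>)) * exp 1"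
      by (simp add: power_add power2_eq_square exp_diff exp_minus field_simps)
    also have "\<dots> \<le> D * exp 1"
      using D[of "1 + \<bar>x\<bar>"] by simp
    finally show ?thesis
      by (simp add: inverse_eq_divide pos_le_divide_eq add_pos_nonneg)
  qed
  then show ?thesis
    by (intro Bochner_Integration.integrable_bound[OF integrable_mult_right
          [OF lborel_integrable_inverse_1_plus_square, of "D * exp 1"]]) 
      (auto intro!: AE_I2 order_trans[OF _ abs_ge_self] simp del: abs_mult)
qed

text \<open>The term of k is spread over the cell [k, k + 1), so the identity is exact. Membership
  is tested on integers because \<open>nat\<close> sends negative floors to 0, which may belong to
  \<open>K\<close>.\<close>

lemma sum_eq_lborel_integral_floor:
  fixes F :: "nat \<Rightarrow> real"
  assumes "finite K"
  shows "has_bochner_integral lborel (\<lambda>y::real. if \<lfloor>y\<rfloor> \<in> int ` K then F (nat \<lfloor>y\<rfloor>) else 0) (\<Sum>k\<in>K. F k)"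
proof -
  have *: "has_bochner_integral lborel (\<lambda>y. \<Sum>k\<in>K. F k * indicator {real k..<real k + 1} y)
      (\<Sum>k\<in>K. F k * 1)"
    by (intro has_bochner_integral_sum has_bochner_integral_mult_right)
      (use has_bochner_integral_real_indicator[of "{real k..<real k + 1}" lborel for k] in auto)
  have "(\<Sum>k\<in>K. F k * indicator {real k..<real k + 1} y)
      = (if \<lfloor>y\<rfloor> \<in> int ` K then F (nat \<lfloor>y\<rfloor>) else 0)" for y :: real
  proof -
    have i: "y \<in> {real k..<real k + 1} \<longleftrightarrow> \<lfloor>y\<rfloor> = int k" for k
      by (auto simp: floor_eq_iff)
    have "(\<Sum>k\<in>K. F k * indicator {real k..<real k + 1} y) = (\<Sum>k\<in>K. if \<lfloor>y\<rfloor> = int k then F k else 0)"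
      using i by (intro sum.cong) (auto simp: indicator_def)
    also have "\<dots> = (if \<lfloor>y\<rfloor> \<in> int ` K then F (nat \<lfloor>y\<rfloor>) else 0)"
    proof (cases "\<lfloor>y\<rfloor> \<in> int ` K")
      case True
      then obtain k where k: "k \<in> K" "\<lfloor>y\<rfloor> = int k" by auto
      then have "(\<Sum>k\<in>K. if \<lfloor>y\<rfloor> = int k then F k else 0) = (\<Sum>l\<in>K. if k = l then F l else 0)"
        by (intro sum.cong) auto
      then show ?thesis using k assms by simp
    qed (auto intro!: sum.neutral)
    finally show ?thesis .
  qed
  with * show ?thesis by simp
qed

text \<open>A mean value estimate. The exponent \<open>p\<close> in place of p - 1 is affordable as
  R \<ge> 1, and it keeps the induction free of truncated subtraction.\<close>

lemma abs_power_diff_le: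
  fixes x y R :: real
  assumes "\<bar>x\<bar> \<le> R" "\<bar>y\<bar> \<le> R" "R \<ge> 1"
  shows "\<bar>x ^ p - y ^ p\<bar> \<le> real p * R ^ p * \<bar>x - y\<bar>"
proof (induction p)
  case (Suc p)
  have "x ^ Suc p - y ^ Suc p = x * (x ^ p - y ^ p) + (x - y) * y ^ p"
    by (simp add: algebra_simps)
  then have "\<bar>x ^ Suc p - y ^ Suc p\<bar> \<le> \<bar>x\<bar> * \<bar>x ^ p - y ^ p\<bar> + \<bar>x - y\<bar> * \<bar>y\<bar> ^ p"
    by (metis abs_mult abs_triangle_ineq power_abs)
  also have "\<dots> \<le> R * (real p * R ^ p * \<bar>x - y\<bar>) + \<bar>x - y\<bar> * R ^ Suc p"
  proof (intro add_mono mult_mono Suc.IH)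
    have "\<bar>y\<bar> ^ p \<le> R ^ p" using assms by (intro power_mono) auto
    also have "\<dots> \<le> R ^ Suc p" using assms by (intro power_increasing) auto
    finally show "\<bar>y\<bar> ^ p \<le> R ^ Suc p" .
  qed (use assms in auto)
  also have "\<dots> = real (Suc p) * R ^ Suc p * \<bar>x - y\<bar>" by (simp add: algebra_simps)
  finally show ?case .
qed simp

text \<open>From 1 - exp (- s) \<le> s. The bound is in terms of a common majorant \<open>w\<close>
  because for large |x| only upper bounds of the exponents are at hand.\<close>

lemma abs_exp_diff_le:
  fixes u v w :: real
  assumes "u \<le> w" "v \<le> w"
  shows "\<bar>exp u - exp v\<bar> \<le> \<bar>u - v\<bar> * exp w"
proof -
  have *: "exp u - exp v \<le> (u - v) * exp w" if "v \<le> u" "u \<le> w" for u v :: real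
  proof -
    have "exp u - exp v = exp u * (1 - exp (v - u))" by (simp add: exp_diff algebra_simps)
    also have "\<dots> \<le> exp w * (u - v)"
    proof (intro mult_mono)
      show "1 - exp (v - u) \<le> u - v" using exp_ge_add_one_self[of "v - u"] by linarith
    qed (use that in auto)
    finally show ?thesis by (simp add: mult.commute)
  qed
  show ?thesis
  proof (cases "v \<le> u")
    case True then show ?thesis using *[of v u] assms by simp
  next
    case False then show ?thesis using *[of u v] assms by simp
  qed
qed

text \<open>On \<open>E\<close> the variable takes finitely many values, so each integral over
  \<open>E\<close> collapses to a finite sum, for arbitrary \<open>g\<close>.\<close>

lemma integral_uniform_measure_discrete:
  fixes g :: "'k \<Rightarrow> real"
  assumes "prob_space M" and X: "X \<in> measurable M (count_space UNIV)" and "finite K"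
    and E: "E = {\<omega> \<in> space M. X \<omega> \<in> K}"
    and p: "\<And>k. k \<in> K \<Longrightarrow> measure M {\<omega> \<in> space M. X \<omega> = k} = p k"
    and pos: "(\<Sum>k\<in>K. p k) > 0"
  shows "(\<integral>\<omega>. g (X \<omega>) \<partial>uniform_measure M E) = (\<Sum>k\<in>K. p k * g k) / (\<Sum>k\<in>K. p k)"
proof -
  interpret prob_space M by fact
  note [measurable] = X
  have sets: "{\<omega> \<in> space M. X \<omega> = k} \<in> sets M" for k by measurable
  have "E = X -` K \<inter> space M" by (auto simp: E)
  then have Em[measurable]: "E \<in> sets M" by simp
  have split: "indicator E \<omega> * h (X \<omega>) = (\<Sum>k\<in>K. h k * indicator {\<omega> \<in> space M. X \<omega> = k} \<omega>)"
    if "\<omega> \<in> space M" for \<omega> and h :: "'k \<Rightarrow> real"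
  proof -
    have "(\<Sum>k\<in>K. h k * indicator {\<omega> \<in> space M. X \<omega> = k} \<omega>) = (\<Sum>k\<in>K. if X \<omega> = k then h k else 0)"
      using that by (intro sum.cong) (auto simp: indicator_def)
    then show ?thesis using \<open>finite K\<close> that by (simp add: E indicator_def)
  qed
  have int: "(\<integral>\<omega>. indicator E \<omega> * h (X \<omega>) \<partial>M) = (\<Sum>k\<in>K. p k * h k)" for h :: "'k \<Rightarrow> real"
  proof -
    have "(\<integral>\<omega>. indicator E \<omega> * h (X \<omega>) \<partial>M)
        = (\<integral>\<omega>. (\<Sum>k\<in>K. h k * indicator {\<omega> \<in> space M. X \<omega> = k} \<omega>) \<partial>M)"
      using split by (intro Bochner_Integration.integral_cong) auto
    also have "\<dots> = (\<Sum>k\<in>K. \<integral>\<omega>. h k * indicator {\<omega> \<in> space M. X \<omega> = k} \<omega> \<partial>M)"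
      using sets by (intro Bochner_Integration.integral_sum integrable_mult_right
          integrable_real_indicator) (auto simp: emeasure_eq_measure)
    also have "\<dots> = (\<Sum>k\<in>K. p k * h k)"
      using sets p by (intro sum.cong) auto
    finally show ?thesis .
  qed
  have mE: "measure M E = (\<Sum>k\<in>K. p k)"
    using int[of "\<lambda>_. 1"] by simp
  \<comment> \<open>Positivity of the mass of \<open>E\<close> allows the \<open>ennreal\<close>
    quotient to be read as a real one.\<close>
  have "uniform_measure M E = density M (\<lambda>\<omega>. ennreal (indicator E \<omega> / measure M E))"
    unfolding uniform_measure_def
  proof (intro arg_cong[where f = "density M"] ext)
    fix \<omega>
    show "indicator E \<omega> / emeasure M E = ennreal (indicator E \<omega> / measure M E)"
      using pos unfolding emeasure_eq_measure mE
      by (subst divide_ennreal[symmetric]) (auto simp: indicator_def)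
  qed
  moreover have "(\<lambda>\<omega>. g (X \<omega>)) \<in> borel_measurable M"
    by (rule measurable_compose[OF X]) simp
  ultimately have "(\<integral>\<omega>. g (X \<omega>) \<partial>uniform_measure M E)
      = (\<integral>\<omega>. (indicator E \<omega> / measure M E) *\<^sub>R g (X \<omega>) \<partial>M)"
    by (simp only:) (subst integral_density; simp)
  also have "\<dots> = (\<integral>\<omega>. (indicator E \<omega> * g (X \<omega>)) / measure M E \<partial>M)"
    by (intro Bochner_Integration.integral_cong) auto
  finally show ?thesis using int[of g] mE by simp
qed

lemma sum_eq_lborel_integral_affine_floor:
  fixes F :: "nat \<Rightarrow> real"
  assumes "finite K" "s > 0"
  shows "has_bochner_integral lborel
    (\<lambda>x::real. if \<lfloor>t + s * x\<rfloor> \<in> int ` K then F (nat \<lfloor>t + s * x\<rfloor>) else 0) ((\<Sum>k\<in>K. F k) / s)"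
  using lborel_has_bochner_integral_real_affine_iff[THEN iffD1, OF _ sum_eq_lborel_integral_floor[OF assms(1), of F], of s t]
    assms(2)
  by (simp add: divide_inverse mult.commute[of _ "inverse s"])

text \<open>The errors of numerator and denominator separate as (U - V) / Iw + V (I - Iw) / (Iw I);
  the bound I / 2 keeps the perturbed denominator away from 0.\<close>

lemma quotient_diff_le:
  fixes U V Iw I :: real
  assumes "I > 0" "Iw \<ge> I / 2"
  shows "\<bar>U / Iw - V / I\<bar> \<le> 2 / I * \<bar>U - V\<bar> + 2 / I\<^sup>2 * \<bar>V\<bar> * \<bar>Iw - I\<bar>"
proof -
  have Iw: "Iw > 0" using assms by linarith
  have "U / Iw - V / I = (U - V) / Iw + V * (I - Iw) / (Iw * I)"
    using Iw assms by (simp add: field_simps)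
  then have "\<bar>U / Iw - V / I\<bar> \<le> \<bar>(U - V) / Iw\<bar> + \<bar>V * (I - Iw) / (Iw * I)\<bar>"
    by (metis abs_triangle_ineq)
  also have "\<dots> = \<bar>U - V\<bar> / Iw + \<bar>V\<bar> * \<bar>Iw - I\<bar> / (Iw * I)"
    using Iw assms by (simp add: abs_mult abs_minus_commute)
  also have "\<dots> \<le> \<bar>U - V\<bar> / (I / 2) + \<bar>V\<bar> * \<bar>Iw - I\<bar> / (I / 2 * I)"
    using Iw assms by (intro add_mono divide_left_mono mult_right_mono mult_pos_pos) auto
  finally show ?thesis by (simp add: power2_eq_square mult_ac)
qed

section \<open>Integrals under an exponential envelope\<close>

text \<open>The limit density decays like exp (c x^(2m)), but the envelope is only exponential:
  replacing an atom by a point at distance at most 1 multiplies exp (- 2 |x|) by a bounded factor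
  and exp (c x^(2m)) by an unbounded one. The power \<open>p\<close> collects the polynomial
  errors.\<close>

definition envelope :: "nat \<Rightarrow> real \<Rightarrow> real" where
  "envelope p x = (1 + \<bar>x\<bar>) ^ p * exp (- 2 * \<bar>x\<bar>)"

lemma envelope_nonneg: "envelope p x \<ge> 0"
  by (simp add: envelope_def)

lemma envelope_mult: "(1 + \<bar>x\<bar>) ^ l * envelope p x = envelope (p + l) x"
  by (simp add: envelope_def power_add)

lemma integrable_envelope: "integrable lborel (envelope p)"
  using integrable_one_plus_abs_power_times_exp[of p] by (simp add: envelope_def[abs_def])

lemma abs_integral_le_envelope:
  assumes "g \<in> borel_measurable lborel" "\<And>x. \<bar>g x\<bar> \<le> C * envelope p x"
  shows "integrable lborel g" "\<bar>\<integral>x. g x \<partial>lborel\<bar> \<le> C * (\<integral>x. envelope p x \<partial>lborel)"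
proof -
  have i: "integrable lborel (\<lambda>x. C * envelope p x)"
    using integrable_envelope by simp
  show g: "integrable lborel g"
    using assms by (intro Bochner_Integration.integrable_bound[OF i])
      (auto intro!: AE_I2 order_trans[OF _ abs_ge_self] simp del: abs_mult)
  have "\<bar>\<integral>x. g x \<partial>lborel\<bar> \<le> (\<integral>x. C * envelope p x \<partial>lborel)"
    using order_trans[OF integral_abs_bound integral_mono[OF integrable_abs[OF g] i]] assms by blast
  then show "\<bar>\<integral>x. g x \<partial>lborel\<bar> \<le> C * (\<integral>x. envelope p x \<partial>lborel)" by simp
qed

lemma Lipschitz_1_borel_measurable:
  fixes \<phi> :: "real \<Rightarrow> real"
  assumes "\<And>x y. \<bar>\<phi> x - \<phi> y\<bar> \<le> \<bar>x - y\<bar>"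
  shows "\<phi> \<in> borel_measurable borel"
proof (rule borel_measurable_continuous_onI)
  have "1-lipschitz_on UNIV \<phi>"
    using assms by (intro lipschitz_onI) (auto simp: dist_real_def)
  then show "continuous_on UNIV \<phi>" by (rule lipschitz_on_continuous_on)
qed

text \<open>
  \<open>W\<close> is a step function and \<open>\<xi>\<close> sends a point to the atom of its cell, so that integrals of
  \<open>W x * \<phi> (\<xi> x)\<close> are sums over atoms, to be compared with integrals against the density \<open>f\<close>.
\<close>

lemma step_integral_close:
  fixes W f \<xi> \<phi> :: "real \<Rightarrow> real"
  assumes f: "f \<in> borel_measurable lborel" "\<And>x. \<bar>f x\<bar> \<le> D * envelope p x"
    and W: "\<And>x. \<bar>W x - f x\<bar> \<le> r * D * envelope p x"
    and \<xi>: "\<And>x. \<bar>\<xi> x - x\<bar> \<le> r"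
    and r: "0 \<le> r" "r \<le> 1" and D: "D \<ge> 0"
    and \<phi>: "\<And>x y. \<bar>\<phi> x - \<phi> y\<bar> \<le> \<bar>x - y\<bar>" "\<phi> 0 = 0"
    and m: "(\<lambda>x. W x * \<phi> (\<xi> x)) \<in> borel_measurable lborel"
  shows "integrable lborel (\<lambda>x. f x * \<phi> x)"
    and "\<bar>\<integral>x. f x * \<phi> x \<partial>lborel\<bar> \<le> D * (\<integral>x. envelope (p + 1) x \<partial>lborel)"
    and "\<bar>(\<integral>x. W x * \<phi> (\<xi> x) \<partial>lborel) - (\<integral>x. f x * \<phi> x \<partial>lborel)\<bar>
      \<le> 2 * r * D * (\<integral>x. envelope (p + 1) x \<partial>lborel)"
proof -
  have [measurable]: "\<phi> \<in> borel_measurable borel" using \<phi>(1) by (rule Lipschitz_1_borel_measurable)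
  have mf: "(\<lambda>x. f x * \<phi> x) \<in> borel_measurable lborel" using f(1) by measurable
  \<comment> \<open>Vanishing at 0 turns the Lipschitz condition into a growth bound; it costs the
    one extra power in \<open>envelope (p + 1)\<close>.\<close>
  have \<phi>': "\<bar>\<phi> x\<bar> \<le> \<bar>x\<bar>" for x using \<phi>(1)[of x 0] \<phi>(2) by simp
  have b1: "\<bar>f x * \<phi> x\<bar> \<le> D * envelope (p + 1) x" for x
  proof -
    have "\<bar>f x * \<phi> x\<bar> \<le> (D * envelope p x) * (1 + \<bar>x\<bar>)"
      unfolding abs_mult using f(2)[of x] \<phi>'[of x] D envelope_nonneg[of p x] by (intro mult_mono) auto
    then show ?thesis using envelope_mult[of x 1 p, symmetric] by (simp add: mult_ac)
  qed
  show if': "integrable lborel (\<lambda>x. f x * \<phi> x)"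
    and "\<bar>\<integral>x. f x * \<phi> x \<partial>lborel\<bar> \<le> D * (\<integral>x. envelope (p + 1) x \<partial>lborel)"
    using abs_integral_le_envelope[OF mf b1] by auto
  have b2: "\<bar>W x * \<phi> (\<xi> x) - f x * \<phi> x\<bar> \<le> 2 * r * D * envelope (p + 1) x" for x
  proof -
    have "\<bar>\<phi> (\<xi> x)\<bar> \<le> 1 + \<bar>x\<bar>" using \<phi>'[of "\<xi> x"] \<xi>[of x] r by linarith
    moreover have "\<bar>\<phi> (\<xi> x) - \<phi> x\<bar> \<le> r" using \<phi>(1)[of "\<xi> x" x] \<xi>[of x] by linarith
    moreover have "W x * \<phi> (\<xi> x) - f x * \<phi> x = (W x - f x) * \<phi> (\<xi> x) + f x * (\<phi> (\<xi> x) - \<phi> x)"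
      by (simp add: algebra_simps)
    ultimately have "\<bar>W x * \<phi> (\<xi> x) - f x * \<phi> x\<bar>
        \<le> (r * D * envelope p x) * (1 + \<bar>x\<bar>) + (D * envelope p x) * r"
      using W[of x] f(2)[of x] r D envelope_nonneg[of p x]
      by (auto simp: abs_mult intro!: order_trans[OF abs_triangle_ineq] add_mono mult_mono)
    also have "\<dots> \<le> (r * D * envelope p x) * (1 + \<bar>x\<bar>) + (D * envelope p x) * (r * (1 + \<bar>x\<bar>))"
      using r D envelope_nonneg[of p x] by (intro add_mono mult_left_mono) (auto simp: algebra_simps)
    also have "\<dots> = 2 * r * D * envelope (p + 1) x"
      using envelope_mult[of x 1 p, symmetric] by (simp add: algebra_simps)
    finally show ?thesis .
  qed
  have "integrable lborel (\<lambda>x. W x * \<phi> (\<xi> x) - f x * \<phi> x)"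
    and *: "\<bar>\<integral>x. W x * \<phi> (\<xi> x) - f x * \<phi> x \<partial>lborel\<bar> \<le> 2 * r * D * (\<integral>x. envelope (p + 1) x \<partial>lborel)"
    using abs_integral_le_envelope[OF _ b2] m mf by auto
  from Bochner_Integration.integrable_add[OF this(1) if']
  have "integrable lborel (\<lambda>x. W x * \<phi> (\<xi> x))" by simp
  with * if' show "\<bar>(\<integral>x. W x * \<phi> (\<xi> x) \<partial>lborel) - (\<integral>x. f x * \<phi> x \<partial>lborel)\<bar>
      \<le> 2 * r * D * (\<integral>x. envelope (p + 1) x \<partial>lborel)" by simp
qed

text \<open>The function |x|^l is not Lipschitz for l \<ge> 2, but for moments boundedness is
  enough: as r \<le> 1, \<open>W\<close> itself lies below twice the envelope, and no comparison of
  the two integrals is made.\<close>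

lemma step_moment_le:
  fixes W f \<xi> :: "real \<Rightarrow> real"
  assumes f: "\<And>x. \<bar>f x\<bar> \<le> D * envelope p x"
    and W: "\<And>x. \<bar>W x - f x\<bar> \<le> r * D * envelope p x"
    and \<xi>: "\<And>x. \<bar>\<xi> x - x\<bar> \<le> r"
    and r: "0 \<le> r" "r \<le> 1" and D: "D \<ge> 0"
    and m: "(\<lambda>x. W x * \<bar>\<xi> x\<bar> ^ l) \<in> borel_measurable lborel"
  shows "\<bar>\<integral>x. W x * \<bar>\<xi> x\<bar> ^ l \<partial>lborel\<bar> \<le> 2 * D * (\<integral>x. envelope (p + l) x \<partial>lborel)"
proof (rule abs_integral_le_envelope[OF m])
  fix x
  have "r * (D * envelope p x) \<le> D * envelope p x"
    using r D envelope_nonneg[of p x] by (intro mult_left_le_one_le) auto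
  then have "\<bar>W x\<bar> \<le> 2 * D * envelope p x" using f[of x] W[of x] by (simp add: mult.assoc)
  moreover have "\<bar>\<xi> x\<bar> ^ l \<le> (1 + \<bar>x\<bar>) ^ l" using \<xi>[of x] r by (intro power_mono) auto
  ultimately have "\<bar>W x * \<bar>\<xi> x\<bar> ^ l\<bar> \<le> (2 * D * envelope p x) * (1 + \<bar>x\<bar>) ^ l"
    unfolding abs_mult using D envelope_nonneg[of p x] by (intro mult_mono) auto
  then show "\<bar>W x * \<bar>\<xi> x\<bar> ^ l\<bar> \<le> 2 * D * envelope (p + l) x"
    by (simp add: envelope_mult[symmetric] mult_ac)
qed

section \<open>Taylor expansions with derivatives relative to the unit interval\<close>

lemma even_power_ge_square_minus_1:
  fixes x :: real
  assumes "m \<ge> 1"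
  shows "x ^ (2 * m) \<ge> x\<^sup>2 - 1"
proof (cases "\<bar>x\<bar> \<ge> 1")
  case True
  then have "1 \<le> x\<^sup>2" using one_le_power[of "\<bar>x\<bar>" 2] by simp
  then have "x\<^sup>2 ^ 1 \<le> x\<^sup>2 ^ m" using assms by (intro power_increasing) auto
  then show ?thesis by (simp add: power_mult)
next
  case False
  then have "x\<^sup>2 \<le> 1" by (simp add: abs_square_le_1)
  moreover have "0 \<le> x ^ (2 * m)" by simp
  ultimately show ?thesis by linarith
qed

text \<open>Every order 2m is reduced to the quadratic case, where completing the square gives an
  explicit constant.\<close>

lemma even_power_dominates_linear:
  fixes \<kappa> C :: real
  assumes "\<kappa> > 0" "m \<ge> 1"
  obtains D where "\<And>x. - \<kappa> * x ^ (2 * m) + C * (1 + \<bar>x\<bar>) \<le> D - 2 * \<bar>x\<bar>"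
proof
  fix x :: real
  have "\<kappa> * x ^ (2 * m) \<ge> \<kappa> * (x\<^sup>2 - 1)"
    using even_power_ge_square_minus_1[OF assms(2)] assms(1) by (intro mult_left_mono) auto
  \<comment> \<open>The coefficient C + 2 is made up of the given slope C and of the 2 in the
    desired decay - 2 |x|.\<close>
  moreover have "0 \<le> (2 * \<kappa> * \<bar>x\<bar> - (C + 2))\<^sup>2 / (4 * \<kappa>)" using assms by simp
  then have "(C + 2) * \<bar>x\<bar> \<le> \<kappa> * x\<^sup>2 + (C + 2)\<^sup>2 / (4 * \<kappa>)"
    using assms by (simp add: power2_diff power_mult_distrib field_simps power2_eq_square)
  ultimately show "- \<kappa> * x ^ (2 * m) + C * (1 + \<bar>x\<bar>) \<le> (\<kappa> + C + (C + 2)\<^sup>2 / (4 * \<kappa>)) - 2 * \<bar>x\<bar>"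
    by (simp add: algebra_simps)
qed

lemma nth_deriv_within_has_real_derivative:
  assumes "Ck_on k S f" "i < k" "open T" "T \<subseteq> S" "t \<in> T"
  shows "(nth_deriv_within S i f has_real_derivative nth_deriv_within S (Suc i) f t) (at t)"
proof -
  have "nth_deriv_within S i f differentiable at t within S"
    using assms by (auto simp: Ck_on_def differentiable_on_def)
  then have "(nth_deriv_within S i f has_vector_derivative
      vector_derivative (nth_deriv_within S i f) (at t within S)) (at t within S)"
    by (simp add: vector_derivative_works)
  moreover have "at t within S = at t"
    using assms by (meson at_within_interior interior_maximal subsetD)
  ultimately show ?thesis
    by (simp add: nth_deriv_within_def has_real_derivative_iff_has_vector_derivative)
qed

lemma Ck_on_continuous_on:
  assumes "Ck_on k S f" "i \<le> k"
  shows "continuous_on S (nth_deriv_within S i f)"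
  using assms by (cases "i = k") (auto simp: Ck_on_def intro: differentiable_imp_continuous_on)

text \<open>\<open>Taylor\<close> expands at a point different from the centre, so t = 0 is treated
  apart, with s = a and a remainder that vanishes because n > 0.\<close>

lemma Taylor_nth_deriv_within:
  assumes "Ck_on k S f" "0 < n" "n \<le> k" "{a - d<..<a + d} \<subseteq> S" "\<bar>t\<bar> < d"
  obtains s where "\<bar>s - a\<bar> < d"
    "f (a + t) = (\<Sum>i<n. nth_deriv_within S i f a / fact i * t ^ i) + nth_deriv_within S n f s / fact n * t ^ n"
proof (cases "t = 0")
  case True
  have "(\<Sum>i<n. nth_deriv_within S i f a / fact i * 0 ^ i) = f a"
    using \<open>0 < n\<close> by (subst sum.remove[of _ 0]) (auto simp: nth_deriv_within_def)
  with True that[of a] assms show ?thesis by simp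
next
  case False
  let ?l = "min a (a + t)" and ?u = "max a (a + t)"
  have "\<exists>s. (if a + t < a then a + t < s \<and> s < a else a < s \<and> s < a + t) \<and>
      f (a + t) = (\<Sum>i<n. nth_deriv_within S i f a / fact i * (a + t - a) ^ i)
        + nth_deriv_within S n f s / fact n * (a + t - a) ^ n"
  proof (rule Taylor)
    show "nth_deriv_within S 0 f = f" by (simp add: nth_deriv_within_def)
    show "\<forall>i s. i < n \<and> ?l \<le> s \<and> s \<le> ?u \<longrightarrow>
        DERIV (nth_deriv_within S i f) s :> nth_deriv_within S (Suc i) f s"
      using assms by (auto intro!: nth_deriv_within_has_real_derivative[of k S f _ "{a - d<..<a + d}"])
  qed (use assms False in auto)
  then obtain s where s: "if a + t < a then a + t < s \<and> s < a else a < s \<and> s < a + t"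
    and eq: "f (a + t) = (\<Sum>i<n. nth_deriv_within S i f a / fact i * (a + t - a) ^ i)
      + nth_deriv_within S n f s / fact n * (a + t - a) ^ n"
    by blast
  show ?thesis
  proof (rule that)
    show "\<bar>s - a\<bar> < d" using s assms(5) by (simp split: if_splits)
  qed (use eq in simp)
qed

text \<open>To be used for B. The second order bound isolates the drift B'(a) t, the first order
  bound serves the upper estimate and the reference point, and the bound on values serves the
  boundary of the window.\<close>

lemma Taylor_first_order:
  assumes "Ck_on 2 {0..1} f" "{a - d<..<a + d} \<subseteq> {0<..<1}"
  obtains L where "L \<ge> 0"
    "\<And>t. \<bar>t\<bar> < d \<Longrightarrow> \<bar>f (a + t) - f a - nth_deriv_within {0..1} 1 f a * t\<bar> \<le> L * t\<^sup>2"
    "\<And>t. \<bar>t\<bar> < d \<Longrightarrow> \<bar>f (a + t) - f a\<bar> \<le> L * \<bar>t\<bar>"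
    "\<And>t. \<bar>t\<bar> < d \<Longrightarrow> \<bar>f (a + t)\<bar> \<le> L"
proof -
  let ?S = "{0..1} :: real set"
  have bd: "\<exists>C. \<forall>x\<in>?S. \<bar>nth_deriv_within ?S i f x\<bar> \<le> C" if "i \<le> 2" for i
    using compact_imp_bounded[OF compact_continuous_image[OF Ck_on_continuous_on[OF assms(1) that]]]
    by (auto simp: bounded_iff)
  obtain C0 C1 C2 where C: "\<And>x. x \<in> ?S \<Longrightarrow> \<bar>nth_deriv_within ?S 0 f x\<bar> \<le> C0"
    "\<And>x. x \<in> ?S \<Longrightarrow> \<bar>nth_deriv_within ?S 1 f x\<bar> \<le> C1"
    "\<And>x. x \<in> ?S \<Longrightarrow> \<bar>nth_deriv_within ?S 2 f x\<bar> \<le> C2"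
    using bd[of 0] bd[of 1] bd[of 2] by force
  define L where "L = \<bar>C0\<bar> + \<bar>C1\<bar> + \<bar>C2\<bar>"
  have sub: "{a - d<..<a + d} \<subseteq> ?S" using assms(2) by force
  have inS: "s \<in> ?S" if "\<bar>s - a\<bar> < d" for s
  proof -
    have "s \<in> {a - d<..<a + d}" using that by (auto simp: abs_less_iff)
    with sub show ?thesis by blast
  qed
  show thesis
  proof
    show "L \<ge> 0" by (simp add: L_def)
    fix t assume t: "\<bar>t\<bar> < d"
    obtain s where s: "\<bar>s - a\<bar> < d"
      "f (a + t) = (\<Sum>i<2. nth_deriv_within ?S i f a / fact i * t ^ i) + nth_deriv_within ?S 2 f s / fact 2 * t ^ 2"
      by (rule Taylor_nth_deriv_within[OF assms(1) _ _ sub t, of 2]) auto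
    have eq: "f (a + t) - f a - nth_deriv_within ?S 1 f a * t = nth_deriv_within ?S 2 f s / 2 * t\<^sup>2"
      unfolding s(2) by (simp add: lessThan_nat_numeral nth_deriv_within_def)
    have "\<bar>nth_deriv_within ?S 2 f s / 2\<bar> \<le> L"
      using C(3)[OF inS[OF s(1)]] by (auto simp: L_def)
    then show "\<bar>f (a + t) - f a - nth_deriv_within ?S 1 f a * t\<bar> \<le> L * t\<^sup>2"
      unfolding eq abs_mult abs_power2 by (intro mult_right_mono) auto
    obtain s where s: "\<bar>s - a\<bar> < d"
      "f (a + t) = (\<Sum>i<1. nth_deriv_within ?S i f a / fact i * t ^ i) + nth_deriv_within ?S 1 f s / fact 1 * t ^ 1"
      by (rule Taylor_nth_deriv_within[OF assms(1) _ _ sub t, of 1]) auto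
    have eq: "f (a + t) - f a = nth_deriv_within ?S 1 f s * t"
      unfolding s(2) by (simp add: nth_deriv_within_def)
    have "\<bar>nth_deriv_within ?S 1 f s\<bar> \<le> L"
      using C(2)[OF inS[OF s(1)]] by (auto simp: L_def)
    then show "\<bar>f (a + t) - f a\<bar> \<le> L * \<bar>t\<bar>"
      unfolding eq by (simp add: abs_mult mult_right_mono)
    show "\<bar>f (a + t)\<bar> \<le> L"
      using C(1)[OF inS[of "a + t"]] t by (auto simp: L_def nth_deriv_within_def)
  qed
qed

text \<open>To be used for A. Expanding to order 2m + 1 gives the rate, stopping at order 2m gives
  the decay through \<kappa>, and the quadratic bound controls the passage from the maximizer to the
  reference grid point.\<close>

lemma Taylor_at_degenerate_max:
  assumes "Ck_on k {0..1} f" "2 * m + 1 \<le> k" "m \<ge> 1" "d > 0" "{a - d<..<a + d} \<subseteq> {0<..<1}"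
    and zero: "\<And>i. 1 \<le> i \<Longrightarrow> i \<le> 2 * m - 1 \<Longrightarrow> nth_deriv_within {0..1} i f a = 0"
    and neg: "\<And>x. \<bar>x - a\<bar> \<le> d \<Longrightarrow> nth_deriv_within {0..1} (2 * m) f x < 0"
    and c: "c = nth_deriv_within {0..1} (2 * m) f a / fact (2 * m)"
  obtains L \<kappa> where "L \<ge> 0" "\<kappa> > 0" "c \<le> - \<kappa>"
    "\<And>t. \<bar>t\<bar> < d \<Longrightarrow> \<bar>f (a + t) - f a - c * t ^ (2 * m)\<bar> \<le> L * \<bar>t\<bar> ^ (2 * m + 1)"
    "\<And>t. \<bar>t\<bar> < d \<Longrightarrow> f (a + t) - f a \<le> - \<kappa> * t ^ (2 * m)"
    "\<And>t. \<bar>t\<bar> < d \<Longrightarrow> \<bar>f (a + t) - f a\<bar> \<le> L * t\<^sup>2"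
proof -
  let ?S = "{0..1} :: real set"
  let ?D = "\<lambda>i. nth_deriv_within ?S i f"
  have bd: "\<exists>C. \<forall>x\<in>?S. \<bar>?D i x\<bar> \<le> C" if "i \<le> 2 * m + 1" for i
    using compact_imp_bounded[OF compact_continuous_image[OF Ck_on_continuous_on[OF assms(1)]]] that assms(2)
    by (auto simp: bounded_iff)
  have sub: "{a - d<..<a + d} \<subseteq> ?S" using assms(5) by force
  have inS: "s \<in> ?S" if "\<bar>s - a\<bar> < d" for s
  proof -
    have "s \<in> {a - d<..<a + d}" using that by (auto simp: abs_less_iff)
    with sub show ?thesis by blast
  qed
  have ends: "{a - d..a + d} \<subseteq> ?S"
    using closure_mono[OF sub] \<open>d > 0\<close> by simp
  have sum: "(\<Sum>i<2 * m. ?D i a / fact i * t ^ i) = f a" for t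
  proof -
    have "?D i a / fact i * t ^ i = 0" if "i \<in> {..<2 * m} - {0}" for i
      using zero[of i] that by auto
    then have "(\<Sum>i\<in>{..<2 * m} - {0}. ?D i a / fact i * t ^ i) = 0" by (rule sum.neutral[rule_format])
    then show ?thesis
      using \<open>m \<ge> 1\<close> by (simp add: sum.remove[of "{..<2 * m}" 0] nth_deriv_within_def)
  qed
  obtain C1 where C1: "\<And>x. x \<in> ?S \<Longrightarrow> \<bar>?D (2 * m) x\<bar> \<le> C1" using bd[of "2 * m"] by force
  obtain C2 where C2: "\<And>x. x \<in> ?S \<Longrightarrow> \<bar>?D (2 * m + 1) x\<bar> \<le> C2" using bd[of "2 * m + 1"] by force
  \<comment> \<open>Compactness of the closed interval turns pointwise negativity into a uniform
    \<kappa> > 0.\<close>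
  have "continuous_on {a - d..a + d} (?D (2 * m))"
    using Ck_on_continuous_on[OF assms(1), of "2 * m"] assms(2) ends continuous_on_subset by force
  then obtain x0 where x0: "x0 \<in> {a - d..a + d}" "\<And>x. x \<in> {a - d..a + d} \<Longrightarrow> ?D (2 * m) x \<le> ?D (2 * m) x0"
    using continuous_attains_sup[of "{a - d..a + d}" "?D (2 * m)"] \<open>d > 0\<close> by auto
  define \<kappa> where "\<kappa> = - ?D (2 * m) x0 / fact (2 * m)"
  define L where "L = \<bar>C1\<bar> + \<bar>C2\<bar>"
  have fact1: "\<bar>y / fact i\<bar> \<le> C" if "\<bar>y\<bar> \<le> C" for y C :: real and i
  proof -
    have "\<bar>y / fact i\<bar> \<le> \<bar>y\<bar> / 1"
      unfolding abs_divide using fact_ge_1[of i, where ?'a = real] by (intro divide_left_mono) auto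
    with that show ?thesis by simp
  qed
  show thesis
  proof
    show "L \<ge> 0" by (simp add: L_def)
    show "\<kappa> > 0" using neg[of x0] x0(1) by (auto simp: \<kappa>_def abs_le_iff intro!: divide_neg_pos)
    show "c \<le> - \<kappa>" using x0(2)[of a] \<open>d > 0\<close> by (simp add: c \<kappa>_def divide_right_mono)
    fix t assume t: "\<bar>t\<bar> < d"
    obtain s where s: "\<bar>s - a\<bar> < d"
      "f (a + t) = (\<Sum>i<2 * m. ?D i a / fact i * t ^ i) + ?D (2 * m) s / fact (2 * m) * t ^ (2 * m)"
      by (rule Taylor_nth_deriv_within[OF assms(1) _ _ sub t, of "2 * m"]) (use assms(2,3) in auto)
    have eq: "f (a + t) - f a = ?D (2 * m) s / fact (2 * m) * t ^ (2 * m)"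
      unfolding s(2) sum by simp
    have "?D (2 * m) s / fact (2 * m) \<le> - \<kappa>"
      using x0(2)[of s] s(1) by (auto simp: \<kappa>_def abs_less_iff intro!: divide_right_mono)
    then show "f (a + t) - f a \<le> - \<kappa> * t ^ (2 * m)"
      unfolding eq by (intro mult_right_mono) auto
    have tm: "\<bar>t\<bar> ^ (2 * m) \<le> t\<^sup>2"
    proof -
      \<comment> \<open>Both a + t and a - t lie in the unit interval, so |t| is small enough for
        powers to decrease in the exponent.\<close>
      have "\<bar>t\<bar> \<le> 1" using inS[of "a + t"] inS[of "a - t"] t by auto
      then have "\<bar>t\<bar> ^ (2 * m) \<le> \<bar>t\<bar> ^ 2" using \<open>m \<ge> 1\<close> by (intro power_decreasing) auto
      then show ?thesis by simp
    qed
    have "\<bar>?D (2 * m) s / fact (2 * m)\<bar> \<le> L"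
      using fact1[OF C1[OF inS[OF s(1)]], of "2 * m"] by (simp add: L_def)
    then have "\<bar>?D (2 * m) s / fact (2 * m)\<bar> * \<bar>t\<bar> ^ (2 * m) \<le> L * t\<^sup>2"
      using tm by (intro mult_mono) (auto simp: L_def)
    then show "\<bar>f (a + t) - f a\<bar> \<le> L * t\<^sup>2"
      unfolding eq by (simp only: abs_mult power_abs)
    obtain s where s: "\<bar>s - a\<bar> < d"
      "f (a + t) = (\<Sum>i<2 * m + 1. ?D i a / fact i * t ^ i) + ?D (2 * m + 1) s / fact (2 * m + 1) * t ^ (2 * m + 1)"
      by (rule Taylor_nth_deriv_within[OF assms(1) _ _ sub t, of "2 * m + 1"]) (use assms(2) in auto)
    have "(\<Sum>i<2 * m + 1. ?D i a / fact i * t ^ i) = f a + c * t ^ (2 * m)"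
      using sum[of t] by (simp only: Suc_eq_plus1[symmetric] sum.lessThan_Suc c)
    then have eq: "f (a + t) - f a - c * t ^ (2 * m) = ?D (2 * m + 1) s / fact (2 * m + 1) * t ^ (2 * m + 1)"
      unfolding s(2) by simp
    have "\<bar>?D (2 * m + 1) s / fact (2 * m + 1)\<bar> \<le> L"
      using fact1[OF C2[OF inS[OF s(1)]], of "2 * m + 1"] by (simp add: L_def)
    then show "\<bar>f (a + t) - f a - c * t ^ (2 * m)\<bar> \<le> L * \<bar>t\<bar> ^ (2 * m + 1)"
      unfolding eq abs_mult power_abs by (intro mult_right_mono) auto
  qed
qed

section \<open>Expansion of the exponent\<close>

text \<open>Arithmetic at a fixed n. In the application \<open>q\<close> is \<open>zoom m n\<close>,
  \<open>Q\<close> is \<open>zoom ms n\<close>, \<open>t\<close> and \<open>t0\<close> are the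
  offsets of a grid point and of the reference point from the maximizer, \<open>\<alpha>t\<close>,
  \<open>\<alpha>0\<close>, \<open>\<beta>t\<close>, \<open>\<beta>0\<close> are the increments of A
  and B from the maximizer, and \<open>dAn\<close>, \<open>dBn\<close> those of A_n and B_n from the
  reference point. The price of the linear term is \<open>e\<close>. The relation q^(2m) = n turns n
  |t|^(2m+1) into |\<xi>|^(2m+1) / q. The constant \<open>C\<close> counts errors: \<open>E1\<close>
  and \<open>E4\<close> give 3 Cs, each of \<open>E2\<close>, \<open>E3\<close>, \<open>E5\<close>,
  \<open>E6\<close> gives L, and \<open>E7\<close> gives |\<beta>|.\<close>

lemma exponent_estimate:
  fixes n q Q e t t0 dAn dBn \<alpha>t \<alpha>0 \<beta>t \<beta>0 \<beta> b c \<kappa> L Cs :: real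
  assumes q: "q \<ge> 1" "0 \<le> Q" "Q \<le> q" "q\<^sup>2 \<le> n" "q ^ (2 * m) = n" and m: "m \<ge> 1"
    and b: "b = \<beta> \<and> Q = q \<and> e \<ge> 0 \<or> b = 0 \<and> e = Q / q"
    and nonneg: "L \<ge> 0" "Cs \<ge> 0"
    and t0: "\<bar>t0\<bar> \<le> 1 / n"
    and A: "\<bar>dAn - (\<alpha>t - \<alpha>0)\<bar> \<le> Cs * \<bar>t - t0\<bar> / n" "\<bar>\<alpha>t - c * t ^ (2 * m)\<bar> \<le> L * \<bar>t\<bar> ^ (2 * m + 1)"
      "\<alpha>t \<le> - \<kappa> * t ^ (2 * m)" "\<bar>\<alpha>0\<bar> \<le> L * t0\<^sup>2"
    and B: "\<bar>dBn - (\<beta>t - \<beta>0)\<bar> \<le> 2 * Cs / n" "\<bar>\<beta>t - \<beta> * t\<bar> \<le> L * t\<^sup>2" "\<bar>\<beta>t\<bar> \<le> L * \<bar>t\<bar>" "\<bar>\<beta>0\<bar> \<le> L * \<bar>t0\<bar>"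
    and \<xi>: "\<xi> = q * t"
    and C: "C = 3 * Cs + 4 * L + \<bar>\<beta>\<bar>"
  shows "\<bar>n * dAn + Q * dBn - (c * \<xi> ^ (2 * m) + b * \<xi>)\<bar> \<le> C * (1 / q + e) * (1 + \<bar>\<xi>\<bar>) ^ (2 * m + 1)"
    and "n * dAn + Q * dBn \<le> - \<kappa> * \<xi> ^ (2 * m) + C * (1 + \<bar>\<xi>\<bar>)"
proof -
  have qn: "q \<le> n" using self_le_power[of q 2] q by linarith
  have n: "n \<ge> 1" using qn q by linarith
  have e: "e \<ge> 0" using b q by auto
  have inv: "1 / n \<le> 1 / q" using qn q by (intro divide_left_mono) auto
  have Qn: "Q / n \<le> 1 / q" 
  proof -
    have "Q * q \<le> q * q" using q by (intro mult_right_mono) auto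
    also have "\<dots> \<le> n" using q(4) by (simp add: power2_eq_square)
    finally have "Q * q \<le> n" .
    then show ?thesis using q n by (simp add: field_simps)
  qed
  have t: "\<bar>t\<bar> = \<bar>\<xi>\<bar> / q" using q by (simp add: \<xi> abs_mult)
  have tt: "\<bar>t - t0\<bar> \<le> (1 + \<bar>\<xi>\<bar>) / q"
    using t t0 inv by (simp add: add_divide_distrib)
  have \<xi>m: "\<xi> ^ (2 * m) = n * t ^ (2 * m)" by (simp add: \<xi> power_mult_distrib q)
  have E1: "\<bar>n * (dAn - (\<alpha>t - \<alpha>0))\<bar> \<le> Cs * (1 + \<bar>\<xi>\<bar>) / q"
  proof -
    have "\<bar>n * (dAn - (\<alpha>t - \<alpha>0))\<bar> \<le> n * (Cs * \<bar>t - t0\<bar> / n)"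
      unfolding abs_mult using A(1) n by (intro mult_mono) auto
    also have "\<dots> \<le> Cs * ((1 + \<bar>\<xi>\<bar>) / q)" using mult_left_mono[OF tt nonneg(2)] n by simp
    finally show ?thesis by simp
  qed
  have E2: "\<bar>n * (\<alpha>t - c * t ^ (2 * m))\<bar> \<le> L * \<bar>\<xi>\<bar> ^ (2 * m + 1) / q"
  proof -
    have "\<bar>n * (\<alpha>t - c * t ^ (2 * m))\<bar> \<le> n * (L * \<bar>t\<bar> ^ (2 * m + 1))"
      unfolding abs_mult using A(2) n by (intro mult_mono) auto
    also have "\<dots> = L * \<bar>\<xi>\<bar> ^ (2 * m + 1) / q"
      using q by (simp add: \<xi> abs_mult power_mult_distrib)
    finally show ?thesis .
  qed
  \<comment> \<open>The cost of using a grid point instead of the maximizer: A is flat to first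
    order there, so n times a quadratic error in 1/n remains.\<close>
  have E3: "\<bar>n * \<alpha>0\<bar> \<le> L * (1 / q)"
  proof -
    have "t0\<^sup>2 \<le> (1 / n)\<^sup>2" using t0 n by (simp add: abs_le_square_iff[symmetric])
    then have "\<bar>n * \<alpha>0\<bar> \<le> n * (L * (1 / n)\<^sup>2)"
      unfolding abs_mult using A(4) n nonneg by (intro mult_mono) (auto intro: order_trans mult_left_mono)
    also have "\<dots> = L * (1 / n)" using n by (simp add: power2_eq_square)
    also have "\<dots> \<le> L * (1 / q)" using inv nonneg by (intro mult_left_mono)
    finally show ?thesis .
  qed
  have E4: "\<bar>Q * (dBn - (\<beta>t - \<beta>0))\<bar> \<le> 2 * Cs * (1 / q)"
  proof -
    have "\<bar>Q * (dBn - (\<beta>t - \<beta>0))\<bar> \<le> Q * (2 * Cs / n)"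
      unfolding abs_mult using B(1) q by (intro mult_mono) auto
    also have "\<dots> = 2 * Cs * (Q / n)" by simp
    also have "\<dots> \<le> 2 * Cs * (1 / q)" using Qn nonneg by (intro mult_left_mono) auto
    finally show ?thesis .
  qed
  have E5: "\<bar>Q * (\<beta>t - \<beta> * t)\<bar> \<le> L * \<xi>\<^sup>2 * (1 / q)"
  proof -
    have "\<bar>Q * (\<beta>t - \<beta> * t)\<bar> \<le> q * (L * t\<^sup>2)"
      unfolding abs_mult using B(2) q by (intro mult_mono) auto
    also have "\<dots> = L * \<xi>\<^sup>2 * (1 / q)" using q by (simp add: \<xi> power2_eq_square)
    finally show ?thesis .
  qed
  have E6: "\<bar>Q * \<beta>0\<bar> \<le> L * (1 / q)"
  proof -
    have "\<bar>\<beta>0\<bar> \<le> L * (1 / n)" using order_trans[OF B(4) mult_left_mono[OF t0 nonneg(1)]] .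
    then have "\<bar>Q * \<beta>0\<bar> \<le> Q * (L * (1 / n))"
      unfolding abs_mult using q by (intro mult_mono) auto
    also have "\<dots> = L * (Q / n)" by simp
    also have "\<dots> \<le> L * (1 / q)" using Qn nonneg by (intro mult_left_mono)
    finally show ?thesis .
  qed
  \<comment> \<open>The only place where the cases differ: for Q = q the linear term equals b \<xi>
    exactly, otherwise it is dropped entirely and counts as error.\<close>
  have E7: "\<bar>Q * (\<beta> * t) - b * \<xi>\<bar> \<le> \<bar>\<beta>\<bar> * (e * \<bar>\<xi>\<bar>)"
    using b
  proof
    assume "b = 0 \<and> e = Q / q"
    then have "\<bar>Q * (\<beta> * t) - b * \<xi>\<bar> = \<bar>\<beta>\<bar> * (e * \<bar>\<xi>\<bar>)"
      using q by (simp add: abs_mult t)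
    then show ?thesis by simp
  qed (auto simp: \<xi>)
  define R where "R = (1 + \<bar>\<xi>\<bar>) ^ (2 * m + 1)"
  have R: "1 + \<bar>\<xi>\<bar> \<le> R" unfolding R_def by (rule self_le_power) auto
  have R2: "\<xi>\<^sup>2 \<le> R"
  proof -
    have "\<xi>\<^sup>2 \<le> (1 + \<bar>\<xi>\<bar>)\<^sup>2" by (simp add: power2_sum)
    also have "\<dots> \<le> R" unfolding R_def using m by (intro power_increasing) auto
    finally show ?thesis .
  qed
  have R3: "\<bar>\<xi>\<bar> ^ (2 * m + 1) \<le> R" unfolding R_def by (intro power_mono) auto
  have mono: "Cs * (1 + \<bar>\<xi>\<bar>) / q \<le> Cs * R / q" "L * \<bar>\<xi>\<bar> ^ (2 * m + 1) / q \<le> L * R / q"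
    "L * (1 / q) \<le> L * R / q" "2 * Cs * (1 / q) \<le> 2 * Cs * R / q" "L * \<xi>\<^sup>2 * (1 / q) \<le> L * R / q"
  proof -
    have aux: "d * y / q \<le> d * R / q" if "y \<le> R" "d \<ge> 0" for d y
      using that q by (intro divide_right_mono mult_left_mono) auto
    show "Cs * (1 + \<bar>\<xi>\<bar>) / q \<le> Cs * R / q" "L * \<bar>\<xi>\<bar> ^ (2 * m + 1) / q \<le> L * R / q"
      using aux R R3 nonneg by blast+
    show "L * (1 / q) \<le> L * R / q" "2 * Cs * (1 / q) \<le> 2 * Cs * R / q" "L * \<xi>\<^sup>2 * (1 / q) \<le> L * R / q"
      using aux[of 1 L] aux[of 1 "2 * Cs"] aux[of "\<xi>\<^sup>2" L] R R2 nonneg by auto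
  qed
  have e7: "\<bar>\<beta>\<bar> * (e * \<bar>\<xi>\<bar>) \<le> \<bar>\<beta>\<bar> * (e * R)"
    using R e by (intro mult_left_mono) auto
  have sum_bound: "\<bar>x1 + x2 - x3 + x4 + x5 - x6 + x7\<bar> \<le> y1 + y2 + y3 + y4 + y5 + y6 + y7"
    if "\<bar>x1\<bar> \<le> y1" "\<bar>x2\<bar> \<le> y2" "\<bar>x3\<bar> \<le> y3" "\<bar>x4\<bar> \<le> y4" "\<bar>x5\<bar> \<le> y5" "\<bar>x6\<bar> \<le> y6" "\<bar>x7\<bar> \<le> y7"
    for x1 x2 x3 x4 x5 x6 x7 y1 y2 y3 y4 y5 y6 y7 :: real
    using that unfolding abs_le_iff by linarith
  have "n * dAn + Q * dBn - (c * \<xi> ^ (2 * m) + b * \<xi>)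
      = n * (dAn - (\<alpha>t - \<alpha>0)) + n * (\<alpha>t - c * t ^ (2 * m)) - n * \<alpha>0
        + Q * (dBn - (\<beta>t - \<beta>0)) + Q * (\<beta>t - \<beta> * t) - Q * \<beta>0 + (Q * (\<beta> * t) - b * \<xi>)"
    unfolding \<xi>m by (simp add: algebra_simps)
  then have "\<bar>n * dAn + Q * dBn - (c * \<xi> ^ (2 * m) + b * \<xi>)\<bar>
      \<le> Cs * R / q + L * R / q + L * R / q + 2 * Cs * R / q + L * R / q + L * R / q + \<bar>\<beta>\<bar> * (e * R)"
    using sum_bound[OF order_trans[OF E1 mono(1)] order_trans[OF E2 mono(2)] order_trans[OF E3 mono(3)]
        order_trans[OF E4 mono(4)] order_trans[OF E5 mono(5)] order_trans[OF E6 mono(3)] order_trans[OF E7 e7]]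
    by simp
  also have "\<dots> = (3 * Cs + 4 * L) * ((1 / q) * R) + \<bar>\<beta>\<bar> * (e * R)" by (simp add: algebra_simps add_divide_distrib)
  also have "\<dots> \<le> (3 * Cs + 4 * L) * ((1 / q + e) * R) + \<bar>\<beta>\<bar> * ((1 / q + e) * R)"
    using R nonneg q e by (intro add_mono mult_left_mono mult_right_mono) auto
  also have "\<dots> = C * (1 / q + e) * R" by (simp add: C algebra_simps)
  finally show "\<bar>n * dAn + Q * dBn - (c * \<xi> ^ (2 * m) + b * \<xi>)\<bar> \<le> C * (1 / q + e) * (1 + \<bar>\<xi>\<bar>) ^ (2 * m + 1)"
    by (simp add: R_def)
  have q1: "1 / q \<le> 1" using q by simp
  have "n * \<alpha>t \<le> - \<kappa> * \<xi> ^ (2 * m)"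
    unfolding \<xi>m using mult_left_mono[OF A(3), of n] n by (simp add: mult_ac)
  moreover have "\<bar>Q * \<beta>t\<bar> \<le> L * \<bar>\<xi>\<bar>"
  proof -
    have "\<bar>Q * \<beta>t\<bar> \<le> q * (L * \<bar>t\<bar>)" unfolding abs_mult using B(3) q by (intro mult_mono) auto
    then show ?thesis using q by (simp add: \<xi> abs_mult mult_ac)
  qed
  moreover have "Cs * (1 + \<bar>\<xi>\<bar>) / q \<le> Cs * (1 + \<bar>\<xi>\<bar>)"
    using mult_left_mono[OF q1, of "Cs * (1 + \<bar>\<xi>\<bar>)"] nonneg by simp
  moreover have "L * (1 / q) \<le> L" "2 * Cs * (1 / q) \<le> 2 * Cs"
    using mult_left_mono[OF q1, of L] mult_left_mono[OF q1, of "2 * Cs"] nonneg by auto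
  moreover have "n * dAn + Q * dBn
      = n * (dAn - (\<alpha>t - \<alpha>0)) + n * \<alpha>t - n * \<alpha>0 + Q * (dBn - (\<beta>t - \<beta>0)) + Q * \<beta>t - Q * \<beta>0"
    by (simp add: algebra_simps)
  ultimately have "n * dAn + Q * dBn
      \<le> - \<kappa> * \<xi> ^ (2 * m) + (Cs * (1 + \<bar>\<xi>\<bar>) + L + 2 * Cs + L * \<bar>\<xi>\<bar> + L)"
    using E1 E3 E4 E6 by linarith
  also have "Cs * (1 + \<bar>\<xi>\<bar>) + L + 2 * Cs + L * \<bar>\<xi>\<bar> + L \<le> C * (1 + \<bar>\<xi>\<bar>)"
    using nonneg by (simp add: C algebra_simps)
  finally show "n * dAn + Q * dBn \<le> - \<kappa> * \<xi> ^ (2 * m) + C * (1 + \<bar>\<xi>\<bar>)" by simp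
qed

text \<open>Here \<open>u\<close> is the exponent at an atom \<xi> and \<open>x\<close> a point of
  its cell. The difference of the exponents carries the factor \<open>r\<close> and polynomial
  growth, while both exponents lie below a constant minus 2 |x|; the mean value bound for exp
  multiplies the two.\<close>

lemma exp_close_envelope:
  fixes \<kappa> b c C :: real
  assumes "\<kappa> > 0" "m \<ge> 1" "c \<le> - \<kappa>" "\<bar>b\<bar> \<le> C"
  obtains D where "D \<ge> 1"
    "\<And>x. exp (c * x ^ (2 * m) + b * x) \<le> D * exp (- 2 * \<bar>x\<bar>)"
    "\<And>r x \<xi> u. \<lbrakk>\<bar>\<xi> - x\<bar> \<le> r; r \<le> 1;
       \<bar>u - (c * \<xi> ^ (2 * m) + b * \<xi>)\<bar> \<le> C * r * (1 + \<bar>\<xi>\<bar>) ^ (2 * m + 1); u \<le> - \<kappa> * \<xi> ^ (2 * m) + C * (1 + \<bar>\<xi>\<bar>)\<rbrakk>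
      \<Longrightarrow> \<bar>exp u - exp (c * x ^ (2 * m) + b * x)\<bar> \<le> r * D * envelope (2 * m + 1) x"
proof -
  have C: "C \<ge> 0" using assms by linarith
  obtain D0 where D0: "\<And>x. - \<kappa> * x ^ (2 * m) + C * (1 + \<bar>x\<bar>) \<le> D0 - 2 * \<bar>x\<bar>"
    using even_power_dominates_linear[OF assms(1,2)] by blast
  have f: "c * x ^ (2 * m) + b * x \<le> D0 - 2 * \<bar>x\<bar>" for x
  proof -
    have "c * x ^ (2 * m) \<le> - \<kappa> * x ^ (2 * m)" using assms(3) by (intro mult_right_mono) auto
    moreover have "b * x \<le> C * (1 + \<bar>x\<bar>)"
    proof -
      have "b * x \<le> \<bar>b\<bar> * \<bar>x\<bar>" by (metis abs_ge_self abs_mult)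
      also have "\<dots> \<le> C * (1 + \<bar>x\<bar>)" using assms(4) C by (intro mult_mono) auto
      finally show ?thesis .
    qed
    ultimately show ?thesis using D0[of x] by linarith
  qed
  define p where "p = 2 * m + 1"
  \<comment> \<open>One summand per source of error: the assumed error at \<xi>, moving the even
    power from \<xi> to x, and moving the linear term. The factors 2^p come from 1 + |\<xi>| \<le> 2
    (1 + |x|).\<close>
  define C1 where "C1 = C * 2 ^ p + \<bar>c\<bar> * real (2 * m) * 2 ^ p + \<bar>b\<bar>"
  have C1: "C1 \<ge> 0" using C by (simp add: C1_def)
  \<comment> \<open>The 2 added to |D0| pays for - 2 |\<xi>| \<le> 2 - 2 |x|.\<close>
  define D where "D = 1 + exp (\<bar>D0\<bar> + 2) * (1 + C1)"
  have D1: "exp (\<bar>D0\<bar> + 2) \<le> D" "C1 * exp (\<bar>D0\<bar> + 2) \<le> D" "D \<ge> 1"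
    using C1 by (simp_all add: D_def algebra_simps)
  show thesis
  proof
    show "D \<ge> 1" by fact
    show "exp (c * x ^ (2 * m) + b * x) \<le> D * exp (- 2 * \<bar>x\<bar>)" for x
    proof -
      have "exp (c * x ^ (2 * m) + b * x) \<le> exp ((\<bar>D0\<bar> + 2) + (- 2 * \<bar>x\<bar>))"
        using f[of x] by simp
      also have "\<dots> \<le> D * exp (- 2 * \<bar>x\<bar>)"
        unfolding exp_add[of "\<bar>D0\<bar> + 2" "- 2 * \<bar>x\<bar>"] using D1 by (intro mult_right_mono) auto
      finally show ?thesis .
    qed
    fix r x \<xi> u :: real
    assume \<xi>: "\<bar>\<xi> - x\<bar> \<le> r" "r \<le> 1"
      and u: "\<bar>u - (c * \<xi> ^ (2 * m) + b * \<xi>)\<bar> \<le> C * r * (1 + \<bar>\<xi>\<bar>) ^ (2 * m + 1)"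
        "u \<le> - \<kappa> * \<xi> ^ (2 * m) + C * (1 + \<bar>\<xi>\<bar>)"
    let ?v = "c * x ^ (2 * m) + b * x"
    define R where "R = (1 + \<bar>x\<bar>) ^ p"
    have r: "r \<ge> 0" using \<xi> by linarith
    have x\<xi>: "\<bar>\<xi>\<bar> \<le> 1 + \<bar>x\<bar>" "\<bar>x\<bar> \<le> 1 + \<bar>\<xi>\<bar>" using \<xi> by linarith+
    have R1: "1 \<le> R" by (simp add: R_def)
    have "(1 + \<bar>\<xi>\<bar>) ^ p \<le> (2 * (1 + \<bar>x\<bar>)) ^ p" using x\<xi> by (intro power_mono) auto
    then have R2: "(1 + \<bar>\<xi>\<bar>) ^ p \<le> 2 ^ p * R" by (simp only: R_def power_mult_distrib)
    have "\<bar>\<xi> ^ (2 * m) - x ^ (2 * m)\<bar> \<le> real (2 * m) * (2 * (1 + \<bar>x\<bar>)) ^ (2 * m) * \<bar>\<xi> - x\<bar>"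
      using x\<xi> by (intro abs_power_diff_le) auto
    also have "\<dots> \<le> real (2 * m) * (2 * (1 + \<bar>x\<bar>)) ^ p * r"
      using \<xi>(1) by (intro mult_mono power_increasing) (auto simp: p_def)
    finally have pw: "\<bar>\<xi> ^ (2 * m) - x ^ (2 * m)\<bar> \<le> real (2 * m) * (2 ^ p * R) * r"
      by (simp only: R_def power_mult_distrib)
    have "u - ?v = (u - (c * \<xi> ^ (2 * m) + b * \<xi>)) + c * (\<xi> ^ (2 * m) - x ^ (2 * m)) + b * (\<xi> - x)"
      by (simp add: algebra_simps)
    then have "\<bar>u - ?v\<bar> \<le> \<bar>u - (c * \<xi> ^ (2 * m) + b * \<xi>)\<bar> + \<bar>c\<bar> * \<bar>\<xi> ^ (2 * m) - x ^ (2 * m)\<bar> + \<bar>b\<bar> * \<bar>\<xi> - x\<bar>"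
      unfolding abs_mult[symmetric] by linarith
    also have "\<dots> \<le> C * r * (2 ^ p * R) + \<bar>c\<bar> * (real (2 * m) * (2 ^ p * R) * r) + \<bar>b\<bar> * (r * R)"
    proof (intro add_mono)
      show "\<bar>u - (c * \<xi> ^ (2 * m) + b * \<xi>)\<bar> \<le> C * r * (2 ^ p * R)"
        using u(1) mult_left_mono[OF R2, of "C * r"] C r unfolding p_def by simp
      show "\<bar>c\<bar> * \<bar>\<xi> ^ (2 * m) - x ^ (2 * m)\<bar> \<le> \<bar>c\<bar> * (real (2 * m) * (2 ^ p * R) * r)"
        using pw by (intro mult_left_mono) auto
      have "\<bar>\<xi> - x\<bar> \<le> r * R" using \<xi>(1) mult_left_mono[OF R1 r] by linarith
      then show "\<bar>b\<bar> * \<bar>\<xi> - x\<bar> \<le> \<bar>b\<bar> * (r * R)" by (intro mult_left_mono) auto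
    qed
    also have "\<dots> = r * C1 * R" by (simp add: C1_def algebra_simps)
    finally have uv: "\<bar>u - ?v\<bar> \<le> r * C1 * R" .
    have "u \<le> (\<bar>D0\<bar> + 2) + (- 2 * \<bar>x\<bar>)" using u(2) D0[of \<xi>] x\<xi> by linarith
    moreover have "?v \<le> (\<bar>D0\<bar> + 2) + (- 2 * \<bar>x\<bar>)" using f[of x] by linarith
    ultimately have "\<bar>exp u - exp ?v\<bar> \<le> \<bar>u - ?v\<bar> * exp ((\<bar>D0\<bar> + 2) + (- 2 * \<bar>x\<bar>))"
      by (rule abs_exp_diff_le)
    also have "\<dots> \<le> (r * C1 * R) * exp ((\<bar>D0\<bar> + 2) + (- 2 * \<bar>x\<bar>))"
      using uv by (intro mult_right_mono) auto
    also have "\<dots> = r * (C1 * exp (\<bar>D0\<bar> + 2)) * envelope (2 * m + 1) x"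
      unfolding exp_add envelope_def R_def p_def by simp
    also have "\<dots> \<le> r * D * envelope (2 * m + 1) x"
      using D1 r envelope_nonneg by (intro mult_right_mono mult_left_mono) auto
    finally show "\<bar>exp u - exp ?v\<bar> \<le> r * D * envelope (2 * m + 1) x" .
  qed
qed

section \<open>The rescaled weights\<close>

definition zoom :: "nat \<Rightarrow> nat \<Rightarrow> real" where
  "zoom m n = real n powr (1 / (2 * real m))"

text \<open>For n \<ge> 1, \<open>zoom ms n\<close> is n times \<open>sigma_star ms n\<close>, the
  strength of the perturbation B_n. A unit of the rescaled coordinate is 1 / \<open>zoom m n\<close>
  in k/n, so the second summand is the slope left over from B when m < ms.\<close>

definition rate :: "nat \<Rightarrow> nat \<Rightarrow> nat \<Rightarrow> real" where
  "rate m ms n = 1 / zoom m n + (if m = ms then 0 else zoom ms n / zoom m n)"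

lemma zoom_properties:
  assumes "m \<ge> 1" "n \<ge> 1"
  shows "zoom m n \<ge> 1" "(zoom m n)\<^sup>2 \<le> real n" "zoom m n ^ (2 * m) = real n" "zoom m n \<le> sqrt (real n)"
    and "m \<le> ms \<Longrightarrow> zoom ms n \<le> zoom m n"
proof -
  show "zoom m n \<ge> 1" using assms by (simp add: zoom_def ge_one_powr_ge_zero)
  have "zoom m n \<le> real n powr (1 / 2)"
    unfolding zoom_def using assms by (intro powr_mono) (auto simp: field_simps)
  then show *: "zoom m n \<le> sqrt (real n)" using assms by (simp add: powr_half_sqrt)
  from power_mono[OF *, of 2] show "(zoom m n)\<^sup>2 \<le> real n" by (simp add: zoom_def)
  show "zoom m n ^ (2 * m) = real n"
    using assms by (simp add: zoom_def powr_power)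
  show "zoom ms n \<le> zoom m n" if "m \<le> ms"
    unfolding zoom_def using that assms by (intro powr_mono) (auto simp: field_simps)
qed

lemma rate_tendsto_0:
  assumes "m \<ge> 1" "m \<le> ms"
  shows "rate m ms \<longlonglongrightarrow> 0"
proof -
  have p: "(\<lambda>n. real n powr e) \<longlonglongrightarrow> 0" if "e < 0" for e
    using that by (rule tendsto_neg_powr) (rule filterlim_real_sequentially)
  have "(\<lambda>n. 1 / zoom m n) \<longlonglongrightarrow> 0"
    using p[of "- (1 / (2 * real m))"] assms by (simp add: zoom_def powr_minus_divide)
  moreover have "(\<lambda>n. if m = ms then 0 else zoom ms n / zoom m n) \<longlonglongrightarrow> 0"
  proof (cases "m = ms")
    case False
    then show ?thesis
      using p[of "1 / (2 * real ms) - 1 / (2 * real m)"] assms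
      by (simp add: zoom_def powr_diff divide_less_cancel frac_less2)
  qed simp
  ultimately show ?thesis
    using tendsto_add[of "\<lambda>n. 1 / zoom m n" 0 sequentially] by (simp add: rate_def[abs_def])
qed

lemma rate_ge: "rate m ms n \<ge> 1 / zoom m n"
  by (simp add: rate_def zoom_def)

text \<open>The budget at a boundary point of the window: - eps n from (A2), L and the logarithm
  from A_n at the reference point, (2 Cs + L) sqrt n from B_n, and 2 \<delta> sqrt n + 2 as a bound
  of 2 |x| there. Both zoom factors are at most sqrt n.\<close>

lemma boundary_exponent_eventually:
  fixes eps Cs L \<delta> :: real
  assumes "eps > 0"
  shows "\<forall>\<^sub>F n in sequentially.
    - eps * real n + L + Cs * ln (real n) + (2 * Cs + L + 2 * \<delta>) * sqrt (real n) + 2 \<le> 0"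
proof -
  have "filterlim (\<lambda>n. - eps * real n + L + Cs * ln (real n) + (2 * Cs + L + 2 * \<delta>) * sqrt (real n) + 2)
      at_bot sequentially"
    using assms by real_asymp
  then show ?thesis by (simp add: filterlim_at_bot)
qed

definition window :: "real \<Rightarrow> real \<Rightarrow> nat \<Rightarrow> nat set" where
  "window a \<delta> n = {k. \<bar>real k - real n * a\<bar> \<le> real n * \<delta>}"

definition rel_weight :: "nat \<Rightarrow> (real \<Rightarrow> real) \<Rightarrow> (real \<Rightarrow> real) \<Rightarrow> real \<Rightarrow> nat \<Rightarrow> nat \<Rightarrow> real" where
  "rel_weight ms F G a n k = exp (hamiltonian ms F G n k - hamiltonian ms F G n (nat \<lfloor>real n * a\<rfloor>))"

text \<open>
  In the rescaled coordinate \<open>x\<close>, where \<open>k = n a + (n / zoom m n) x\<close>, the weights become the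
  following step function.
\<close>

definition step_weight :: "nat \<Rightarrow> nat \<Rightarrow> (real \<Rightarrow> real) \<Rightarrow> (real \<Rightarrow> real) \<Rightarrow> real \<Rightarrow> real \<Rightarrow> nat \<Rightarrow> real \<Rightarrow> real" where
  "step_weight m ms F G a \<delta> n x =
     (let k = \<lfloor>real n * a + real n / zoom m n * x\<rfloor>
      in if k \<in> int ` window a \<delta> n then rel_weight ms F G a n (nat k) else 0)"

text \<open>The integer floor makes this the left end of the cell of x for every real x, outside the
  window and for negative indices too, so that \<open>atom_close\<close> holds without
  restriction.\<close>

definition atom :: "nat \<Rightarrow> real \<Rightarrow> nat \<Rightarrow> real \<Rightarrow> real" where
  "atom m a n x = zoom m n * (real_of_int \<lfloor>real n * a + real n / zoom m n * x\<rfloor> / real n - a)"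

lemma atom_close:
  assumes "m \<ge> 1" "n \<ge> 1"
  shows "\<bar>atom m a n x - x\<bar> \<le> 1 / zoom m n"
proof -
  define q where "q = zoom m n"
  define y where "y = real n * a + real n / q * x"
  note q = zoom_properties[OF assms, folded q_def]
  have "x = q * (y / real n - a)" using q(1) assms by (simp add: y_def field_simps)
  then have "atom m a n x - x = q / real n * (real_of_int \<lfloor>y\<rfloor> - y)"
    using q(1) assms by (simp add: atom_def q_def[symmetric] y_def[symmetric] field_simps)
  then have "\<bar>atom m a n x - x\<bar> = q / real n * \<bar>real_of_int \<lfloor>y\<rfloor> - y\<bar>"
    using q(1) by (simp add: abs_mult)
  also have "\<dots> \<le> q / real n * 1"
    using q(1) by (intro mult_left_mono) (auto simp: abs_le_iff, linarith+)
  also have "\<dots> \<le> 1 / q" using q(1,2) assms by (simp add: field_simps power2_eq_square)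
  finally show ?thesis by (simp add: q_def)
qed

text \<open>Three kinds of x, according to the grid point of their cell: outside the window the step
  weight is 0, strictly inside \<open>exponent_estimate\<close> applies, and on the boundary (A2)
  takes over. Points beyond the boundary are removed by the conditioning, so (A2) is asked for only
  at distance exactly \<delta>.\<close>

lemma step_weight_close:
  fixes An Bn :: "nat \<Rightarrow> real \<Rightarrow> real" and A B :: "real \<Rightarrow> real"
  assumes m: "m \<ge> 1" "m \<le> ms" and pos: "eps > 0" "\<delta> > 0" "Cs > 0"
    and sub: "{a - \<delta><..<a + \<delta>} \<subseteq> {0<..<1}"
    and const: "L \<ge> 0" "\<kappa> > 0" "c \<le> - \<kappa>"
    and TA: "\<And>t. \<bar>t\<bar> < \<delta> \<Longrightarrow> \<bar>A (a + t) - A a - c * t ^ (2 * m)\<bar> \<le> L * \<bar>t\<bar> ^ (2 * m + 1)"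
      "\<And>t. \<bar>t\<bar> < \<delta> \<Longrightarrow> A (a + t) - A a \<le> - \<kappa> * t ^ (2 * m)"
      "\<And>t. \<bar>t\<bar> < \<delta> \<Longrightarrow> \<bar>A (a + t) - A a\<bar> \<le> L * t\<^sup>2"
    and TB: "\<And>t. \<bar>t\<bar> < \<delta> \<Longrightarrow> \<bar>B (a + t) - B a - \<beta> * t\<bar> \<le> L * t\<^sup>2"
      "\<And>t. \<bar>t\<bar> < \<delta> \<Longrightarrow> \<bar>B (a + t) - B a\<bar> \<le> L * \<bar>t\<bar>"
      "\<And>t. \<bar>t\<bar> < \<delta> \<Longrightarrow> \<bar>B (a + t)\<bar> \<le> L"
    and b: "b = \<beta> * (if m = ms then 1 else 0)"
    and A2: "\<forall>\<^sub>F n in sequentially. \<forall>k\<le>n. \<bar>real k / real n - a\<bar> = \<delta> \<longrightarrow>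
        An n (real k / real n) \<le> A a - eps \<and> \<bar>Bn n (real k / real n)\<bar> \<le> Cs"
    and A3: "\<forall>\<^sub>F n in sequentially. \<forall>k\<le>n. \<forall>l\<le>n.
      \<bar>real k / real n - a\<bar> < \<delta> \<and> \<bar>real l / real n - a\<bar> < \<delta> \<longrightarrow>
        \<bar>An n (real k / real n) - A (real k / real n)\<bar> \<le> Cs * (ln (real n) / real n) \<and>
        \<bar>Bn n (real k / real n) - B (real k / real n)\<bar> \<le> Cs / real n \<and>
        \<bar>(An n (real k / real n) - An n (real l / real n)) -
          (A (real k / real n) - A (real l / real n))\<bar> \<le> Cs * \<bar>real k - real l\<bar> / (real n)\<^sup>2"
  obtains D where "D \<ge> 0"
    "\<And>x. \<bar>exp (c * x ^ (2 * m) + b * x)\<bar> \<le> D * envelope (2 * m + 1) x"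
    "\<forall>\<^sub>F n in sequentially. \<forall>x. \<bar>step_weight m ms (An n) (Bn n) a \<delta> n x - exp (c * x ^ (2 * m) + b * x)\<bar>
        \<le> rate m ms n * D * envelope (2 * m + 1) x"
proof -
  define f where "f x = exp (c * x ^ (2 * m) + b * x)" for x
  define C where "C = 3 * Cs + 4 * L + \<bar>\<beta>\<bar>"
  have "\<bar>b\<bar> \<le> C" using pos const by (simp add: b C_def)
  then obtain D1 where D1: "D1 \<ge> 1" "\<And>x. f x \<le> D1 * exp (- 2 * \<bar>x\<bar>)"
    "\<And>r x \<xi> u. \<lbrakk>\<bar>\<xi> - x\<bar> \<le> r; r \<le> 1;
       \<bar>u - (c * \<xi> ^ (2 * m) + b * \<xi>)\<bar> \<le> C * r * (1 + \<bar>\<xi>\<bar>) ^ (2 * m + 1); u \<le> - \<kappa> * \<xi> ^ (2 * m) + C * (1 + \<bar>\<xi>\<bar>)\<rbrakk>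
      \<Longrightarrow> \<bar>exp u - f x\<bar> \<le> r * D1 * envelope (2 * m + 1) x"
    unfolding f_def using exp_close_envelope[OF const(2) m(1) const(3), of b C] by metis
  \<comment> \<open>Covers \<open>D1\<close> for interior points and \<open>D1 / \<delta>\<close>
    for the others.\<close>
  define D where "D = D1 * (1 + 1 / \<delta>)"
  have D: "D1 \<le> D" "D1 / \<delta> \<le> D" using D1(1) pos by (simp_all add: D_def algebra_simps)
  have f0: "f x \<ge> 0" for x by (simp add: f_def)
  have sub': "0 \<le> a - \<delta>" "a + \<delta> \<le> 1"
    using closure_mono[OF sub] pos by auto
  have ev: "\<forall>\<^sub>F n in sequentially. n \<ge> 1 \<and> 1 / real n < \<delta> \<and> rate m ms n \<le> 1"
  proof (intro eventually_conj)
    show "\<forall>\<^sub>F n in sequentially. 1 / real n < \<delta>"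
      using order_tendstoD(2)[OF lim_1_over_n pos(2)] .
    show "\<forall>\<^sub>F n in sequentially. rate m ms n \<le> 1"
      using order_tendstoD(2)[OF rate_tendsto_0[OF m], of 1] by (simp add: eventually_mono less_imp_le)
  qed (rule eventually_ge_at_top)
  have main: "\<forall>\<^sub>F n in sequentially. \<forall>x. \<bar>step_weight m ms (An n) (Bn n) a \<delta> n x - f x\<bar>
        \<le> rate m ms n * D * envelope (2 * m + 1) x"
    using ev A2 A3 boundary_exponent_eventually[OF pos(1), of L Cs \<delta>]
  proof eventually_elim
    case (elim n)
    define q where "q = zoom m n"
    define Q where "Q = zoom ms n"
    define r where "r = rate m ms n"
    define k0 where "k0 = nat \<lfloor>real n * a\<rfloor>"
    define t0 where "t0 = real k0 / real n - a"
    have n: "n \<ge> 1" "1 / real n < \<delta>" "r \<le> 1" using elim by (auto simp: r_def)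
    note q = zoom_properties[OF m(1) n(1), folded q_def]
    have Q: "0 \<le> Q" "Q \<le> q" using q(5)[OF m(2)] by (auto simp: Q_def zoom_def)
    have Qs: "Q \<le> sqrt (real n)" using Q q(4) by linarith
    have r: "r \<ge> 1 / q" "1 / q \<ge> 0" using rate_ge[of m n ms] q(1) by (auto simp: r_def q_def)
    have r0: "r \<ge> 0" using r by linarith
    have H: "hamiltonian ms F G n k = real n * F (real k / real n) + Q * G (real k / real n)" for F G k
    proof -
      have "real n * sigma_star ms n = real n powr (1 + (- 1 + 1 / (2 * real ms)))"
        using n(1) unfolding sigma_star_def powr_add by simp
      then show ?thesis by (simp add: hamiltonian_def Q_def zoom_def)
    qed
    have "real n * a \<ge> 0" using sub' pos by simp
    then have k0: "real k0 \<le> real n * a" "real n * a < real k0 + 1"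
      by (simp_all add: k0_def)
    have t0: "\<bar>t0\<bar> \<le> 1 / real n"
    proof -
      have "t0 = (real k0 - real n * a) / real n" using n(1) by (simp add: t0_def field_simps)
      then show ?thesis using k0 n(1) by (simp add: divide_right_mono)
    qed
    have t0': "\<bar>t0\<bar> < \<delta>" "real k0 / real n = a + t0" using t0 n by (auto simp: t0_def)
    have k0n: "k0 \<le> n"
    proof -
      have "real n * a \<le> real n * 1" using sub' pos by (intro mult_left_mono) auto
      then show ?thesis using k0 by linarith
    qed
    \<comment> \<open>On and beyond the boundary there is no cancellation: \<open>w\<close> and
      \<open>f x\<close> are nonnegative and each is below D1 exp (- 2 |x|). The rate comes from
      \<delta> q \<le> 1 + |x|.\<close>
    have out: "\<bar>w - f x\<bar> \<le> r * D * envelope (2 * m + 1) x"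
      if "\<bar>atom m a n x\<bar> \<ge> \<delta> * q" "0 \<le> w" "w \<le> exp (- 2 * \<bar>x\<bar>)" for w x
    proof -
      have "exp (- 2 * \<bar>x\<bar>) \<le> D1 * exp (- 2 * \<bar>x\<bar>)" using D1(1) by simp
      then have "\<bar>w - f x\<bar> \<le> D1 * exp (- 2 * \<bar>x\<bar>) * 1"
        using that f0[of x] D1(2)[of x] by linarith
      also have "1 \<le> (1 + \<bar>x\<bar>) * (1 / q) / \<delta>"
      proof -
        have "1 / q \<le> 1" using q(1) by simp
        then have "\<delta> * q \<le> 1 + \<bar>x\<bar>" using that(1) atom_close[OF m(1) n(1), of a x, folded q_def] by linarith
        then show ?thesis using q(1) pos by (simp add: field_simps)
      qed
      also have "(1 + \<bar>x\<bar>) * (1 / q) / \<delta> \<le> (1 + \<bar>x\<bar>) ^ (2 * m + 1) * r / \<delta>"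
        using r pos self_le_power[of "1 + \<bar>x\<bar>" "2 * m + 1"] by (intro divide_right_mono mult_mono) auto
      finally have "\<bar>w - f x\<bar> \<le> D1 * exp (- 2 * \<bar>x\<bar>) * ((1 + \<bar>x\<bar>) ^ (2 * m + 1) * r / \<delta>)"
        using D1(1) by (simp add: mult_left_mono)
      also have "\<dots> = r * (D1 / \<delta>) * envelope (2 * m + 1) x" by (simp add: envelope_def)
      also have "\<dots> \<le> r * D * envelope (2 * m + 1) x"
        using D(2) r0 envelope_nonneg by (intro mult_right_mono mult_left_mono) auto
      finally show ?thesis .
    qed
    show ?case
    proof
      fix x
      define k where "k = \<lfloor>real n * a + real n / q * x\<rfloor>"
      have at: "atom m a n x = q * (real_of_int k / real n - a)"
        by (simp add: atom_def k_def q_def)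
      have at': "\<bar>atom m a n x\<bar> = q * \<bar>real_of_int k - real n * a\<bar> / real n"
      proof -
        have "real_of_int k / real n - a = (real_of_int k - real n * a) / real n"
          using n(1) by (simp add: field_simps)
        then show ?thesis using q(1) by (simp add: at abs_mult)
      qed
      show "\<bar>step_weight m ms (An n) (Bn n) a \<delta> n x - f x\<bar> \<le> rate m ms n * D * envelope (2 * m + 1) x"
      proof (cases "k \<in> int ` window a \<delta> n")
        case False
        have "\<bar>real_of_int k - real n * a\<bar> \<ge> real n * \<delta>"
        proof (cases "k \<ge> 0")
          case True
          then have "k = int (nat k)" by simp
          with False have "nat k \<notin> window a \<delta> n" by (metis image_eqI)
          then show ?thesis using True by (simp add: window_def)
        next
          case neg: False
          \<comment> \<open>Negative indices lie outside the window as well, because a \<ge>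
            \<delta>.\<close>
          have "real n * \<delta> \<le> real n * a" using sub' by (intro mult_left_mono) auto
          moreover have "real_of_int k \<le> 0" using neg by simp
          ultimately show ?thesis by linarith
        qed
        then have "q * (real n * \<delta>) / real n \<le> \<bar>atom m a n x\<bar>"
          unfolding at' using q(1) by (intro divide_right_mono mult_left_mono) auto
        then have "\<bar>atom m a n x\<bar> \<ge> \<delta> * q" using n(1) by (simp add: mult.commute)
        from out[OF this, of 0] show ?thesis
          using False by (simp add: step_weight_def k_def[unfolded q_def] r_def Let_def)
      next
        case True
        then obtain l where l: "l \<in> window a \<delta> n" "k = int l" by auto
        define t where "t = real l / real n - a"
        have at'': "atom m a n x = q * t" by (simp add: at l t_def)
        have "t = (real l - real n * a) / real n" using n(1) by (simp add: t_def field_simps)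
        then have t: "\<bar>t\<bar> \<le> \<delta>" "real l / real n = a + t"
          using l n(1) by (auto simp: window_def field_simps t_def)
        have "real l / real n \<le> 1" using t sub' by linarith
        then have ln: "l \<le> n" using n(1) by simp
        define dA where "dA = An n (real l / real n) - An n (real k0 / real n)"
        define dB where "dB = Bn n (real l / real n) - Bn n (real k0 / real n)"
        define u where "u = real n * dA + Q * dB"
        have sw: "step_weight m ms (An n) (Bn n) a \<delta> n x = exp u"
        proof -
          have "u = hamiltonian ms (An n) (Bn n) n l - hamiltonian ms (An n) (Bn n) n k0"
            by (simp add: H u_def dA_def dB_def algebra_simps)
          then show ?thesis
            unfolding step_weight_def k_def[unfolded q_def, symmetric] Let_def
            using True l by (simp add: rel_weight_def k0_def)
        qed
        have near: "\<bar>An n (real k0 / real n) - A (real k0 / real n)\<bar> \<le> Cs * (ln (real n) / real n)"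
          "\<bar>Bn n (real k0 / real n) - B (real k0 / real n)\<bar> \<le> Cs / real n"
          using elim(3)[rule_format, OF k0n k0n] t0'(1)[unfolded t0_def] by auto
        show ?thesis
        proof (cases "\<bar>t\<bar> < \<delta>")
          case True
          have *: "\<bar>Bn n (real l / real n) - B (real l / real n)\<bar> \<le> Cs / real n"
            "\<bar>dA - (A (real l / real n) - A (real k0 / real n))\<bar> \<le> Cs * \<bar>real l - real k0\<bar> / (real n)\<^sup>2"
            using elim(3)[rule_format, OF ln k0n] t0'(1)[unfolded t0_def] True[unfolded t_def]
            unfolding dA_def by auto
          have dA: "\<bar>dA - ((A (a + t) - A a) - (A (a + t0) - A a))\<bar> \<le> Cs * \<bar>t - t0\<bar> / real n"
          proof -
            have "\<bar>real l - real k0\<bar> = real n * \<bar>t - t0\<bar>"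
            proof -
              have "real l - real k0 = real n * (t - t0)" using n(1) by (simp add: t_def t0_def field_simps)
              then show ?thesis by (simp add: abs_mult)
            qed
            then show ?thesis using *(2) n(1) t t0' by (simp add: power2_eq_square)
          qed
          have dB: "\<bar>dB - ((B (a + t) - B a) - (B (a + t0) - B a))\<bar> \<le> 2 * Cs / real n"
            using *(1) near(2) t t0' by (simp add: dB_def)
          define e where "e = (if m = ms then 0 else Q / q)"
          have re: "r = 1 / q + e" by (simp add: r_def rate_def e_def Q_def q_def)
          have be: "b = \<beta> \<and> Q = q \<and> e \<ge> 0 \<or> b = 0 \<and> e = Q / q"
            by (simp add: b e_def Q_def q_def)
          have "\<bar>u - (c * (q * t) ^ (2 * m) + b * (q * t))\<bar> \<le> C * (1 / q + e) * (1 + \<bar>q * t\<bar>) ^ (2 * m + 1)"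
            "u \<le> - \<kappa> * (q * t) ^ (2 * m) + C * (1 + \<bar>q * t\<bar>)"
            unfolding u_def
            using exponent_estimate[OF q(1) Q q(2,3) m(1) be const(1) less_imp_le[OF pos(3)] t0 dA TA(1)[OF True] TA(2)[OF True]
                TA(3)[OF t0'(1)] dB TB(1)[OF True] TB(2)[OF True] TB(2)[OF t0'(1)] refl C_def] by auto
          then have "\<bar>exp u - f x\<bar> \<le> r * D1 * envelope (2 * m + 1) x"
            using atom_close[OF m(1) n(1), of a x, folded q_def] r n(3)
            unfolding at'' re[symmetric] by (intro D1(3)) auto
          also have "\<dots> \<le> r * D * envelope (2 * m + 1) x"
            using D r0 envelope_nonneg by (intro mult_right_mono mult_left_mono) auto
          finally show ?thesis by (simp add: sw r_def)
        next
          case False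
          then have t\<delta>: "\<bar>t\<bar> = \<delta>" using t by simp
          have bd: "An n (real l / real n) \<le> A a - eps" "\<bar>Bn n (real l / real n)\<bar> \<le> Cs"
            using elim(2)[rule_format, OF ln] t\<delta>[unfolded t_def] by auto
          have n1: "1 / real n \<le> 1" using n(1) by simp
          have "t0\<^sup>2 \<le> (1 / real n)\<^sup>2" using t0 by (simp add: abs_le_square_iff[symmetric])
          also have "\<dots> \<le> 1 / real n" unfolding power2_eq_square using n1 by (intro mult_left_le) auto
          finally have "L * t0\<^sup>2 \<le> L * (1 / real n)" using const by (intro mult_left_mono)
          then have "dA \<le> - eps + L * (1 / real n) + Cs * (ln (real n) / real n)"
            using bd(1) near(1) TA(3)[OF t0'(1)] unfolding dA_def t0'(2) by linarith
          then have "real n * dA \<le> real n * (- eps + L * (1 / real n) + Cs * (ln (real n) / real n))"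
            by (intro mult_left_mono) auto
          also have "\<dots> = - eps * real n + L + Cs * ln (real n)" using n(1) by (simp add: algebra_simps)
          finally have 1: "real n * dA \<le> - eps * real n + L + Cs * ln (real n)" .
          have "Cs / real n \<le> Cs" using n(1) pos by (simp add: divide_le_eq)
          then have "dB \<le> 2 * Cs + L" using bd(2) near(2) TB(3)[OF t0'(1)] unfolding dB_def t0'(2) by linarith
          then have "Q * dB \<le> Q * (2 * Cs + L)" using Q by (intro mult_left_mono)
          also have "\<dots> \<le> sqrt (real n) * (2 * Cs + L)" using Qs pos const by (intro mult_right_mono) auto
          finally have 2: "Q * dB \<le> (2 * Cs + L) * sqrt (real n)" by (simp add: mult.commute)
          have "\<bar>atom m a n x\<bar> = \<delta> * q" using q(1) by (simp add: at'' abs_mult t\<delta>)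
          moreover have "\<delta> * q \<le> \<delta> * sqrt (real n)" using q(4) pos by (intro mult_left_mono) auto
          moreover have "1 / q \<le> 1" using q(1) by simp
          ultimately have "\<bar>x\<bar> \<le> \<delta> * sqrt (real n) + 1"
            using atom_close[OF m(1) n(1), of a x, folded q_def] by linarith
          then have "u \<le> - 2 * \<bar>x\<bar>" using 1 2 elim(4) unfolding u_def by (simp add: algebra_simps)
          then show ?thesis
            using out[of x "exp u"] \<open>\<bar>atom m a n x\<bar> = \<delta> * q\<close> by (simp add: sw r_def)
        qed
      qed
    qed
  qed
  have env: "\<bar>f x\<bar> \<le> D * envelope (2 * m + 1) x" for x
  proof -
    have "exp (- 2 * \<bar>x\<bar>) \<le> envelope (2 * m + 1) x"
      unfolding envelope_def using one_le_power[of "1 + \<bar>x\<bar>" "2 * m + 1"] by simp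
    then have "D1 * exp (- 2 * \<bar>x\<bar>) \<le> D * envelope (2 * m + 1) x"
      using D(1) D1(1) by (intro mult_mono) auto
    then show ?thesis using D1(2)[of x] f0[of x] by linarith
  qed
  show thesis
    using that[of D] D(1) D1(1) env main unfolding f_def by simp
qed

section \<open>Conditional expectations\<close>

lemma finite_window: "finite (window a \<delta> n)"
proof (rule finite_subset)
  show "window a \<delta> n \<subseteq> {..nat \<lfloor>real n * a + real n * \<delta>\<rfloor>}"
    by (auto simp: window_def abs_le_iff intro!: le_nat_floor)
qed simp

lemma window_subset:
  assumes "a + \<delta> \<le> 1"
  shows "window a \<delta> n \<subseteq> {..n}"
proof
  fix k assume "k \<in> window a \<delta> n"
  then have "real k \<le> real n * (a + \<delta>)" by (auto simp: window_def abs_le_iff algebra_simps)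
  also have "\<dots> \<le> real n * 1" using assms by (intro mult_left_mono) auto
  finally show "k \<in> {..n}" by simp
qed

lemma floor_in_window:
  assumes "0 \<le> a" "1 / real n \<le> \<delta>" "n \<ge> 1"
  shows "nat \<lfloor>real n * a\<rfloor> \<in> window a \<delta> n"
proof -
  have "1 \<le> real n * \<delta>" using assms by (simp add: field_simps)
  moreover have "0 \<le> real n * a" using assms by simp
  ultimately show ?thesis by (simp add: window_def abs_le_iff) linarith
qed

text \<open>The divisor is the number of cells per unit of x. It does not depend on \<phi> and so
  cancels against the case \<phi> = 1.\<close>

lemma step_weight_integral:
  assumes "m \<ge> 1" "n \<ge> 1"
  shows "has_bochner_integral lborel (\<lambda>x. step_weight m ms F G a \<delta> n x * \<phi> (atom m a n x))
    ((\<Sum>k\<in>window a \<delta> n. rel_weight ms F G a n k * \<phi> (zoom m n * (real k / real n - a))) / (real n / zoom m n))"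
proof -
  have s: "real n / zoom m n > 0" using zoom_properties(1)[OF assms] assms by simp
  have "step_weight m ms F G a \<delta> n x * \<phi> (atom m a n x) =
      (if \<lfloor>real n * a + real n / zoom m n * x\<rfloor> \<in> int ` window a \<delta> n
       then (\<lambda>k. rel_weight ms F G a n k * \<phi> (zoom m n * (real k / real n - a)))
         (nat \<lfloor>real n * a + real n / zoom m n * x\<rfloor>) else 0)" for x
    unfolding step_weight_def atom_def Let_def by auto
  then show ?thesis
    using sum_eq_lborel_integral_affine_floor[OF finite_window s, where F =
        "\<lambda>k. rel_weight ms F G a n k * \<phi> (zoom m n * (real k / real n - a))"] by simp
qed

lemma conditional_expectation_eq:
  fixes g :: "nat \<Rightarrow> real"
  assumes "prob_space M" "X \<in> measurable M (count_space UNIV)"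
    and distr: "\<And>k. k \<le> n \<Longrightarrow> measure M {\<omega> \<in> space M. X \<omega> = k} = exp (hamiltonian ms F G n k) / partition_fun ms F G n"
    and "a + \<delta> \<le> 1" "0 \<le> a" "1 / real n \<le> \<delta>" "n \<ge> 1"
    and E: "E = {\<omega> \<in> space M. \<bar>real (X \<omega>) - real n * a\<bar> \<le> real n * \<delta>}"
  shows "(\<integral>\<omega>. g (X \<omega>) \<partial>uniform_measure M E) =
    (\<Sum>k\<in>window a \<delta> n. rel_weight ms F G a n k * g k) / (\<Sum>k\<in>window a \<delta> n. rel_weight ms F G a n k)"
proof -
  let ?K = "window a \<delta> n" and ?H = "hamiltonian ms F G n" and ?Z = "partition_fun ms F G n"
  \<comment> \<open>The probability of the reference point; it cancels, and the partition function
    with it.\<close>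
  define \<alpha> where "\<alpha> = exp (?H (nat \<lfloor>real n * a\<rfloor>)) / ?Z"
  have Z: "?Z > 0" unfolding partition_fun_def by (intro sum_pos) auto
  then have \<alpha>: "\<alpha> > 0" by (simp add: \<alpha>_def)
  have p: "exp (?H k) / ?Z = \<alpha> * rel_weight ms F G a n k" for k
    by (simp add: \<alpha>_def rel_weight_def exp_diff)
  have pos: "(\<Sum>k\<in>?K. exp (?H k) / ?Z) > 0"
    using floor_in_window[of a n \<delta>] assms Z by (intro sum_pos finite_window) auto
  have "(\<integral>\<omega>. g (X \<omega>) \<partial>uniform_measure M E) = (\<Sum>k\<in>?K. exp (?H k) / ?Z * g k) / (\<Sum>k\<in>?K. exp (?H k) / ?Z)"
    using window_subset[of a \<delta> n] assms(4) pos
    by (intro integral_uniform_measure_discrete[OF assms(1,2) finite_window]) (auto simp: E window_def intro!: distr)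
  also have "\<dots> = (\<alpha> * (\<Sum>k\<in>?K. rel_weight ms F G a n k * g k)) / (\<alpha> * (\<Sum>k\<in>?K. rel_weight ms F G a n k))"
    unfolding p by (simp add: sum_distrib_left mult.assoc)
  finally show ?thesis using \<alpha> by simp
qed

text \<open>The probabilistic part enters only through the functionals \<open>\<mu> n\<close>. The
  quantifier over \<phi> stands inside the eventuality because the Wasserstein supremum needs one
  constant and one threshold for all test functions.\<close>

lemma step_expectation_limit:
  fixes W \<xi> :: "nat \<Rightarrow> real \<Rightarrow> real" and \<mu> :: "nat \<Rightarrow> (real \<Rightarrow> real) \<Rightarrow> real"
  assumes f: "f \<in> borel_measurable lborel" "\<And>x. \<bar>f x\<bar> \<le> D * envelope p x" "(\<integral>x. f x \<partial>lborel) > 0"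
    and D: "D \<ge> 0"
    and r: "\<And>n. r n \<ge> 0" "r \<longlonglongrightarrow> 0"
    and W: "\<forall>\<^sub>F n in sequentially. \<forall>x. \<bar>W n x - f x\<bar> \<le> r n * D * envelope p x"
    and \<xi>: "\<forall>\<^sub>F n in sequentially. \<forall>x. \<bar>\<xi> n x - x\<bar> \<le> r n"
    and \<mu>: "\<forall>\<^sub>F n in sequentially. \<forall>\<phi>. integrable lborel (\<lambda>x. W n x * \<phi> (\<xi> n x)) \<and>
      \<mu> n \<phi> = (\<integral>x. W n x * \<phi> (\<xi> n x) \<partial>lborel) / (\<integral>x. W n x \<partial>lborel)"
  shows "\<exists>C. \<forall>\<^sub>F n in sequentially. \<bar>\<mu> n (\<lambda>x. \<bar>x\<bar> ^ l)\<bar> \<le> C"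
    and "\<exists>C. \<forall>\<^sub>F n in sequentially. \<forall>\<phi>. (\<forall>x y. \<bar>\<phi> x - \<phi> y\<bar> \<le> \<bar>x - y\<bar>) \<longrightarrow>
      \<bar>\<mu> n \<phi> - (\<integral>x. f x * \<phi> x \<partial>lborel) / (\<integral>x. f x \<partial>lborel)\<bar> \<le> C * r n"
proof -
  let ?S = "\<lambda>p. \<integral>x. envelope p x \<partial>lborel"
  define I where "I = (\<integral>x. f x \<partial>lborel)"
  have I: "I > 0" using f by (simp add: I_def)
  have S: "?S p \<ge> 0" for p by (intro integral_nonneg_AE) (simp add: envelope_nonneg)
  have if': "integrable lborel f" using abs_integral_le_envelope(1)[OF f(1,2)] .
  have mass: "\<forall>\<^sub>F n in sequentially. \<bar>(\<integral>x. W n x \<partial>lborel) - I\<bar> \<le> r n * D * ?S p"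
    using W \<mu>
  proof eventually_elim
    case (elim n)
    \<comment> \<open>The constant test function singles out the total mass.\<close>
    from elim(2)[rule_format, of "\<lambda>_. 1"] have iW: "integrable lborel (W n)" by simp
    have "\<bar>\<integral>x. W n x - f x \<partial>lborel\<bar> \<le> r n * D * ?S p"
      using elim(1) iW if' by (intro abs_integral_le_envelope) auto
    then show ?case using iW if' by (simp add: I_def)
  qed
  have "(\<lambda>n. r n * D * ?S p) \<longlonglongrightarrow> 0" using tendsto_mult_left_zero[OF tendsto_mult_left_zero[OF r(2)]] .
  then have "\<forall>\<^sub>F n in sequentially. r n * D * ?S p < I / 2" using I by (intro order_tendstoD(2)) auto
  with mass have half: "\<forall>\<^sub>F n in sequentially. (\<integral>x. W n x \<partial>lborel) \<ge> I / 2"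
    by eventually_elim (auto simp: abs_le_iff)
  have r1: "\<forall>\<^sub>F n in sequentially. r n \<le> 1"
    using order_tendstoD(2)[OF r(2), of 1] by (simp add: eventually_mono less_imp_le)
  show "\<exists>C. \<forall>\<^sub>F n in sequentially. \<bar>\<mu> n (\<lambda>x. \<bar>x\<bar> ^ l)\<bar> \<le> C"
  proof
    show "\<forall>\<^sub>F n in sequentially. \<bar>\<mu> n (\<lambda>x. \<bar>x\<bar> ^ l)\<bar> \<le> 2 * D * ?S (p + l) / (I / 2)"
      using W \<xi> \<mu> half r1
    proof eventually_elim
      case (elim n)
      from elim(3)[rule_format, of "\<lambda>x. \<bar>x\<bar> ^ l"]
      have "\<bar>\<integral>x. W n x * \<bar>\<xi> n x\<bar> ^ l \<partial>lborel\<bar> \<le> 2 * D * ?S (p + l)"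
        using elim f D r by (intro step_moment_le[of f D p "W n" "r n" "\<xi> n" l]) auto
      then have "\<bar>\<integral>x. W n x * \<bar>\<xi> n x\<bar> ^ l \<partial>lborel\<bar> / (\<integral>x. W n x \<partial>lborel) \<le> 2 * D * ?S (p + l) / (I / 2)"
        using elim(4) I by (intro frac_le) auto
      moreover have "(\<integral>x. W n x \<partial>lborel) > 0" using elim(4) I by linarith
      ultimately show ?case using elim(3) by (simp add: abs_divide)
    qed
  qed
  define C where "C = 2 / I * (2 * D * ?S (p + 1)) + 2 / I\<^sup>2 * (D * ?S (p + 1)) * (D * ?S p)"
  show "\<exists>C. \<forall>\<^sub>F n in sequentially. \<forall>\<phi>. (\<forall>x y. \<bar>\<phi> x - \<phi> y\<bar> \<le> \<bar>x - y\<bar>) \<longrightarrow>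
      \<bar>\<mu> n \<phi> - (\<integral>x. f x * \<phi> x \<partial>lborel) / (\<integral>x. f x \<partial>lborel)\<bar> \<le> C * r n"
  proof
    show "\<forall>\<^sub>F n in sequentially. \<forall>\<phi>. (\<forall>x y. \<bar>\<phi> x - \<phi> y\<bar> \<le> \<bar>x - y\<bar>) \<longrightarrow>
      \<bar>\<mu> n \<phi> - (\<integral>x. f x * \<phi> x \<partial>lborel) / (\<integral>x. f x \<partial>lborel)\<bar> \<le> C * r n"
      using W \<xi> \<mu> half r1 mass
    proof eventually_elim
      case (elim n)
      show ?case
      proof (intro allI impI)
        fix \<phi> :: "real \<Rightarrow> real"
        assume lip: "\<forall>x y. \<bar>\<phi> x - \<phi> y\<bar> \<le> \<bar>x - y\<bar>"
        \<comment> \<open>Both sides average with total weight 1, so the constant \<phi> 0,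
          unbounded over the test functions, drops out of the difference.\<close>
        define \<psi> where "\<psi> x = \<phi> x - \<phi> 0" for x
        define Iw where "Iw = (\<integral>x. W n x \<partial>lborel)"
        define U where "U = (\<integral>x. W n x * \<psi> (\<xi> n x) \<partial>lborel)"
        define V where "V = (\<integral>x. f x * \<psi> x \<partial>lborel)"
        have Iw: "Iw \<ge> I / 2" using elim(4) by (simp add: Iw_def)
        then have Iw0: "Iw > 0" using I by linarith
        have iW: "integrable lborel (W n)" using elim(3)[rule_format, of "\<lambda>_. 1"] by simp
        have i\<psi>: "integrable lborel (\<lambda>x. W n x * \<psi> (\<xi> n x))" using elim(3) by blast
        have close: "integrable lborel (\<lambda>x. f x * \<psi> x)" "\<bar>V\<bar> \<le> D * ?S (p + 1)" "\<bar>U - V\<bar> \<le> 2 * r n * D * ?S (p + 1)"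
          unfolding U_def V_def
          using step_integral_close[of f D p "W n" "r n" "\<xi> n" \<psi>] elim f D r lip i\<psi> by (auto simp: \<psi>_def)
        have "\<mu> n \<phi> = (\<integral>x. W n x * \<psi> (\<xi> n x) + \<phi> 0 * W n x \<partial>lborel) / Iw"
          using elim(3) by (simp add: Iw_def \<psi>_def algebra_simps)
        also have "\<dots> = U / Iw + \<phi> 0" using i\<psi> iW Iw0 by (simp add: U_def Iw_def add_divide_distrib)
        finally have 1: "\<mu> n \<phi> = U / Iw + \<phi> 0" .
        have "(\<integral>x. f x * \<phi> x \<partial>lborel) = (\<integral>x. f x * \<psi> x + \<phi> 0 * f x \<partial>lborel)"
          by (simp add: \<psi>_def algebra_simps)
        also have "\<dots> = V + \<phi> 0 * I" using close(1) if' by (simp add: V_def I_def)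
        finally have 2: "(\<integral>x. f x * \<phi> x \<partial>lborel) / I = V / I + \<phi> 0" using I by (simp add: add_divide_distrib)
        have "\<bar>\<mu> n \<phi> - (\<integral>x. f x * \<phi> x \<partial>lborel) / I\<bar> = \<bar>U / Iw - V / I\<bar>" unfolding 1 2 by simp
        also have "\<dots> \<le> 2 / I * \<bar>U - V\<bar> + 2 / I\<^sup>2 * \<bar>V\<bar> * \<bar>Iw - I\<bar>"
          by (rule quotient_diff_le[OF I Iw])
        also have "\<dots> \<le> 2 / I * (2 * r n * D * ?S (p + 1)) + 2 / I\<^sup>2 * (D * ?S (p + 1)) * (r n * D * ?S p)"
          using close elim(6) I D S by (intro add_mono mult_mono mult_left_mono) (auto simp: Iw_def)
        also have "\<dots> = C * r n" by (simp add: C_def algebra_simps)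
        finally show "\<bar>\<mu> n \<phi> - (\<integral>x. f x * \<phi> x \<partial>lborel) / (\<integral>x. f x \<partial>lborel)\<bar> \<le> C * r n"
          by (simp add: I_def)
      qed
    qed
  qed
qed

section \<open>The limit law and the assembly\<close>

text \<open>The normalising constant is known only to exist; total mass 1 identifies it. A
  nonpositive \<open>K\<close> is excluded because \<open>ennreal\<close> would then turn the
  density into 0.\<close>

lemma distributed_const_mult_integral:
  fixes f \<phi> :: "real \<Rightarrow> real"
  assumes "prob_space N" and Y: "distributed N lborel Y (\<lambda>x. ennreal (K * f x))" and f: "\<And>x. f x > 0"
    and [measurable]: "\<phi> \<in> borel_measurable borel"
  shows "(\<integral>x. f x \<partial>lborel) > 0"
    and "(\<integral>y. \<phi> y \<partial>distr N borel Y) = (\<integral>x. f x * \<phi> x \<partial>lborel) / (\<integral>x. f x \<partial>lborel)"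
proof -
  interpret prob_space N by fact
  have K: "K > 0"
  proof (rule ccontr)
    assume "\<not> K > 0"
    then have "ennreal (K * f x) = 0" for x
      using f[of x] by (intro ennreal_neg) (simp add: mult_nonpos_nonneg)
    then have "emeasure N (Y -` UNIV \<inter> space N) = 0"
      using distributed_emeasure[OF Y, of UNIV] by simp
    then show False using emeasure_space_1 by simp
  qed
  have int: "(\<integral>x. K * f x * g x \<partial>lborel) = (\<integral>\<omega>. g (Y \<omega>) \<partial>N)" if "g \<in> borel_measurable borel" for g :: "real \<Rightarrow> real"
    using distributed_integral[OF Y, of g] that K f by (simp add: less_imp_le)
  \<comment> \<open>This also rules out that the integral is merely the default value 0 of a
    non-integrable function.\<close>
  have "K * (\<integral>x. f x \<partial>lborel) = 1" using int[of "\<lambda>_. 1"] by (simp add: prob_space)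
  then show pos: "(\<integral>x. f x \<partial>lborel) > 0" using K by (metis zero_less_mult_pos zero_less_one)
  have Y': "Y \<in> measurable N borel" using distributed_measurable[OF Y] by simp
  have "(\<integral>y. \<phi> y \<partial>distr N borel Y) = (\<integral>x. K * f x * \<phi> x \<partial>lborel)"
    using int[of \<phi>] Y' by (simp add: integral_distr)
  also have "\<dots> = K * (\<integral>x. f x * \<phi> x \<partial>lborel)" by (simp add: mult.assoc)
  finally show "(\<integral>y. \<phi> y \<partial>distr N borel Y) = (\<integral>x. f x * \<phi> x \<partial>lborel) / (\<integral>x. f x \<partial>lborel)"
    using \<open>K * _ = 1\<close> pos by (simp add: field_simps)
qed

theorem theorem2p4:
  fixes ms :: nat
    and An Bn :: "nat \<Rightarrow> real \<Rightarrow> real"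
    and A B :: "real \<Rightarrow> real"
    and eps \<delta> Cs :: real
    and J :: "'j set" and a :: "'j \<Rightarrow> real" and m :: "'j \<Rightarrow> nat"
    and M :: "nat \<Rightarrow> 'a measure" and X :: "nat \<Rightarrow> 'a \<Rightarrow> nat"
    and N :: "'j \<Rightarrow> 'b measure" and Y :: "'j \<Rightarrow> 'b \<Rightarrow> real"
    and E :: "'j \<Rightarrow> nat \<Rightarrow> 'a set" and c b :: "'j \<Rightarrow> real"
  assumes ms: "ms \<ge> 1"
    and pos: "eps > 0" "\<delta> > 0" "Cs > 0"
    and J: "finite J"
    and a: "\<And>j. j \<in> J \<Longrightarrow> 0 < a j \<and> a j < 1"
    and m: "\<And>j. j \<in> J \<Longrightarrow> m j \<ge> 1"
    and A: "Ck_on (2 * ms + 1) {0..1} A"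
    and B: "Ck_on 2 {0..1} B"
    \<comment> \<open>the random variables \<open>X\<^sub>n\<close>\<close>
    and X_prob: "\<And>n. n \<ge> 1 \<Longrightarrow> prob_space (M n)"
    and X_meas: "\<And>n. n \<ge> 1 \<Longrightarrow> X n \<in> measurable (M n) (count_space UNIV)"
    and X_distr: "\<And>n k. n \<ge> 1 \<Longrightarrow> k \<le> n \<Longrightarrow>
      measure (M n) {\<omega> \<in> space (M n). X n \<omega> = k} =
        exp (hamiltonian ms (An n) (Bn n) n k) / partition_fun ms (An n) (Bn n) n"
    \<comment> \<open>condition (A1)\<close>
    and A1_maximizers: "a ` J = {x \<in> {0..1}. \<forall>y\<in>{0..1}. A y \<le> A x}"
    and A1_ms: "Max (m ` J) = ms"
    and A1_zero: "\<And>j i. j \<in> J \<Longrightarrow> 1 \<le> i \<Longrightarrow> i \<le> 2 * m j - 1 \<Longrightarrow>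
      nth_deriv_within {0..1} i A (a j) = 0"
    and A1_neg: "\<And>j x. j \<in> J \<Longrightarrow> \<bar>x - a j\<bar> \<le> \<delta> \<Longrightarrow> nth_deriv_within {0..1} (2 * m j) A x < 0"
    and A1_disjoint: "disjoint_family_on (\<lambda>j. {a j - \<delta><..<a j + \<delta>}) J"
    and A1_subset: "\<And>j. j \<in> J \<Longrightarrow> {a j - \<delta><..<a j + \<delta>} \<subseteq> {0<..<1}"
    \<comment> \<open>condition (A2)\<close>
    and A2: "\<forall>\<^sub>F n in sequentially. \<forall>k\<le>n.
      (\<forall>j\<in>J. \<bar>real k / real n - a j\<bar> \<ge> \<delta>) \<longrightarrow>
        An n (real k / real n) \<le> (SUP x\<in>{0..1}. A x) - eps \<and> \<bar>Bn n (real k / real n)\<bar> \<le> Cs"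
    \<comment> \<open>condition (A3)\<close>
    and A3: "\<forall>\<^sub>F n in sequentially. \<forall>k\<le>n. \<forall>l\<le>n.
      (\<exists>j\<in>J. \<bar>real k / real n - a j\<bar> < \<delta> \<and> \<bar>real l / real n - a j\<bar> < \<delta>) \<longrightarrow>
        \<bar>An n (real k / real n) - A (real k / real n)\<bar> \<le> Cs * (ln (real n) / real n) \<and>
        \<bar>Bn n (real k / real n) - B (real k / real n)\<bar> \<le> Cs / real n \<and>
        \<bar>(An n (real k / real n) - An n (real l / real n)) -
          (A (real k / real n) - A (real l / real n))\<bar> \<le> Cs * \<bar>real k - real l\<bar> / (real n)\<^sup>2"
    \<comment> \<open>the conditioning events\<close>
    and E: "\<And>j n. E j n = {\<omega> \<in> space (M n). \<bar>real (X n \<omega>) - real n * a j\<bar> \<le> real n * \<delta>}"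
    \<comment> \<open>the limiting random variables \<open>Y\<^sub>j\<close>\<close>
    and c: "\<And>j. c j = nth_deriv_within {0..1} (2 * m j) A (a j) / fact (2 * m j)"
    and b: "\<And>j. b j = nth_deriv_within {0..1} 1 B (a j) * (if m j = ms then 1 else 0)"
    and Y_prob: "\<And>j. j \<in> J \<Longrightarrow> prob_space (N j)"
    and Y_distr: "\<And>j. j \<in> J \<Longrightarrow>
      \<exists>K. distributed (N j) lborel (Y j) (\<lambda>x. ennreal (K * exp (c j * x ^ (2 * m j) + b j * x)))"
  shows "(\<forall>j\<in>J. \<forall>l::nat\<ge>1.
            (\<lambda>n. \<integral>\<omega>. \<bar>real (X n \<omega>) / real n - a j\<bar> ^ l \<partial>uniform_measure (M n) (E j n))
              \<in> O(\<lambda>n. real n powr (- real l / (2 * real (m j)))))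
    \<and> (\<forall>j\<in>J. \<exists>C1 C2. \<forall>\<^sub>F n in sequentially.
            wasserstein
              (cond_law (M n) (E j n)
                (\<lambda>\<omega>. real n powr (1 / (2 * real (m j))) * (real (X n \<omega>) / real n - a j)))
              (distr (N j) borel (Y j))
            \<le> ennreal (C1 * real n powr (- 1 / (2 * real (m j)))
                + C2 * real n powr (1 / (2 * real ms) - 1 / (2 * real (m j)))
                    * (if m j \<noteq> ms then 1 else 0)))"
proof -
  have bounds: "\<exists>C. \<forall>\<^sub>F n in sequentially.
          \<bar>\<integral>\<omega>. \<bar>zoom (m j) n * (real (X n \<omega>) / real n - a j)\<bar> ^ l \<partial>uniform_measure (M n) (E j n)\<bar> \<le> C"
    and wass: "\<exists>C\<ge>0. \<forall>\<^sub>F n in sequentially.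
            wasserstein (cond_law (M n) (E j n) (\<lambda>\<omega>. zoom (m j) n * (real (X n \<omega>) / real n - a j))) (distr (N j) borel (Y j))
            \<le> ennreal (C * rate (m j) ms n)"
    if j: "j \<in> J" for j l
  proof -
    \<comment> \<open>The bound by \<open>ms\<close> ensures enough derivatives of A for the
      expansion at \<open>a j\<close>, and a rate that tends to 0.\<close>
    have mj: "m j \<ge> 1" "m j \<le> ms" using m[OF j] A1_ms J j by auto
    have sub: "0 \<le> a j - \<delta>" "a j + \<delta> \<le> 1"
      using closure_mono[OF A1_subset[OF j]] pos by auto
    have sub01: "{a j - \<delta><..<a j + \<delta>} \<subseteq> {0<..<1}" by (rule A1_subset[OF j])
    define \<beta> where "\<beta> = nth_deriv_within {0..1} 1 B (a j)"
    obtain L1 \<kappa> where L1: "L1 \<ge> 0" "\<kappa> > 0" "c j \<le> - \<kappa>"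
      "\<And>t. \<bar>t\<bar> < \<delta> \<Longrightarrow> \<bar>A (a j + t) - A (a j) - c j * t ^ (2 * m j)\<bar> \<le> L1 * \<bar>t\<bar> ^ (2 * m j + 1)"
      "\<And>t. \<bar>t\<bar> < \<delta> \<Longrightarrow> A (a j + t) - A (a j) \<le> - \<kappa> * t ^ (2 * m j)"
      "\<And>t. \<bar>t\<bar> < \<delta> \<Longrightarrow> \<bar>A (a j + t) - A (a j)\<bar> \<le> L1 * t\<^sup>2"
      by (rule Taylor_at_degenerate_max[OF A _ mj(1) pos(2) sub01 A1_zero[OF j] A1_neg[OF j] c[of j]])
        (use mj in auto)
    obtain L2 where L2: "L2 \<ge> 0" "\<And>t. \<bar>t\<bar> < \<delta> \<Longrightarrow> \<bar>B (a j + t) - B (a j) - \<beta> * t\<bar> \<le> L2 * t\<^sup>2"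
      "\<And>t. \<bar>t\<bar> < \<delta> \<Longrightarrow> \<bar>B (a j + t) - B (a j)\<bar> \<le> L2 * \<bar>t\<bar>" "\<And>t. \<bar>t\<bar> < \<delta> \<Longrightarrow> \<bar>B (a j + t)\<bar> \<le> L2"
      using Taylor_first_order[OF B sub01, folded \<beta>_def] by blast
    define L where "L = L1 + L2"
    have le: "L1 * y \<le> L * y" "L2 * y \<le> L * y" if "y \<ge> 0" for y
      using that L1(1) L2(1) by (auto simp: L_def algebra_simps)
    have A2j: "\<forall>\<^sub>F n in sequentially. \<forall>k\<le>n. \<bar>real k / real n - a j\<bar> = \<delta> \<longrightarrow>
        An n (real k / real n) \<le> A (a j) - eps \<and> \<bar>Bn n (real k / real n)\<bar> \<le> Cs"
      using A2
    proof eventually_elim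
      case (elim n)
      have "a j \<in> {x \<in> {0..1}. \<forall>y\<in>{0..1}. A y \<le> A x}" using A1_maximizers j by blast
      then have sup: "(SUP x\<in>{0..1}. A x) = A (a j)" by (intro cSup_eq_maximum) auto
      show ?case
      proof (intro allI impI)
        fix k assume k: "k \<le> n" "\<bar>real k / real n - a j\<bar> = \<delta>"
        have "\<delta> \<le> \<bar>real k / real n - a i\<bar>" if i: "i \<in> J" for i
        proof (cases "i = j")
          case False
          then have "{a i - \<delta><..<a i + \<delta>} \<inter> {a j - \<delta><..<a j + \<delta>} = {}"
            using A1_disjoint i j by (auto simp: disjoint_family_on_def)
          \<comment> \<open>An open set that misses a set also misses its closure. Hence an end
            point of the window of \<open>j\<close> avoids all the other open windows too and falls
            under (A2).\<close>
          then have "{a i - \<delta><..<a i + \<delta>} \<inter> closure {a j - \<delta><..<a j + \<delta>} = {}"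
            by (subst open_Int_closure_eq_empty) auto
          moreover have "real k / real n \<in> closure {a j - \<delta><..<a j + \<delta>}"
            using k(2) pos by (auto simp: abs_if split: if_splits)
          ultimately have "real k / real n \<notin> {a i - \<delta><..<a i + \<delta>}" by blast
          then show ?thesis by (auto simp: abs_if)
        qed (use k in simp)
        with elim k sup show "An n (real k / real n) \<le> A (a j) - eps \<and> \<bar>Bn n (real k / real n)\<bar> \<le> Cs"
          by simp
      qed
    qed
    have A3j: "\<forall>\<^sub>F n in sequentially. \<forall>k\<le>n. \<forall>l\<le>n.
      \<bar>real k / real n - a j\<bar> < \<delta> \<and> \<bar>real l / real n - a j\<bar> < \<delta> \<longrightarrow>
        \<bar>An n (real k / real n) - A (real k / real n)\<bar> \<le> Cs * (ln (real n) / real n) \<and>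
        \<bar>Bn n (real k / real n) - B (real k / real n)\<bar> \<le> Cs / real n \<and>
        \<bar>(An n (real k / real n) - An n (real l / real n)) -
          (A (real k / real n) - A (real l / real n))\<bar> \<le> Cs * \<bar>real k - real l\<bar> / (real n)\<^sup>2"
      using A3 by eventually_elim (use j in blast)
    define f where "f x = exp (c j * x ^ (2 * m j) + b j * x)" for x
    obtain D where D: "D \<ge> 0" "\<And>x. \<bar>f x\<bar> \<le> D * envelope (2 * m j + 1) x"
      "\<forall>\<^sub>F n in sequentially. \<forall>x. \<bar>step_weight (m j) ms (An n) (Bn n) (a j) \<delta> n x - f x\<bar>
        \<le> rate (m j) ms n * D * envelope (2 * m j + 1) x"
      unfolding f_def
    proof (rule step_weight_close[OF mj pos sub01 _ L1(2,3) _ L1(5) _ _ _ _ b[of j, folded \<beta>_def] A2j A3j])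
      show "0 \<le> L" using L1 L2 by (simp add: L_def)
      fix t :: real assume t: "\<bar>t\<bar> < \<delta>"
      show "\<bar>t\<bar> < \<delta>" by (rule t)
      show "\<bar>A (a j + t) - A (a j) - c j * t ^ (2 * m j)\<bar> \<le> L * \<bar>t\<bar> ^ (2 * m j + 1)"
        by (rule order_trans[OF L1(4)[OF t] le(1)]) simp
      show "\<bar>A (a j + t) - A (a j)\<bar> \<le> L * t\<^sup>2"
        by (rule order_trans[OF L1(6)[OF t] le(1)]) simp
      show "\<bar>B (a j + t) - B (a j) - \<beta> * t\<bar> \<le> L * t\<^sup>2"
        by (rule order_trans[OF L2(2)[OF t] le(2)]) simp
      show "\<bar>B (a j + t) - B (a j)\<bar> \<le> L * \<bar>t\<bar>"
        by (rule order_trans[OF L2(3)[OF t] le(2)]) simp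
      show "\<bar>B (a j + t)\<bar> \<le> L"
        using L2(4)[OF t] L1(1) by (simp add: L_def)
    qed (rule that[unfolded f_def])
    define \<mu> where "\<mu> n \<phi> = (\<integral>\<omega>. \<phi> (zoom (m j) n * (real (X n \<omega>) / real n - a j)) \<partial>uniform_measure (M n) (E j n))"
      for n and \<phi> :: "real \<Rightarrow> real"
    let ?W = "\<lambda>n. step_weight (m j) ms (An n) (Bn n) (a j) \<delta> n" and ?\<xi> = "atom (m j) (a j)"
    have ev1: "\<forall>\<^sub>F n in sequentially. n \<ge> 1" by (rule eventually_ge_at_top)
    have \<mu>: "\<forall>\<^sub>F n in sequentially. \<forall>\<phi>. integrable lborel (\<lambda>x. ?W n x * \<phi> (?\<xi> n x)) \<and>
        \<mu> n \<phi> = (\<integral>x. ?W n x * \<phi> (?\<xi> n x) \<partial>lborel) / (\<integral>x. ?W n x \<partial>lborel)"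
      using ev1 order_tendstoD(2)[OF lim_1_over_n pos(2)]
    proof eventually_elim
      case (elim n)
      have z: "zoom (m j) n \<noteq> 0" "n \<noteq> 0" using zoom_properties(1)[OF mj(1) elim(1)] elim(1) by auto
      show ?case
      proof (intro allI conjI)
        fix \<phi> :: "real \<Rightarrow> real"
        note int = step_weight_integral[OF mj(1) elim(1), of ms "An n" "Bn n" "a j" \<delta>, THEN has_bochner_integral_iff[THEN iffD1]]
        show "integrable lborel (\<lambda>x. ?W n x * \<phi> (?\<xi> n x))" using int[of \<phi>] by simp
        have "\<mu> n \<phi> = (\<Sum>k\<in>window (a j) \<delta> n. rel_weight ms (An n) (Bn n) (a j) n k * \<phi> (zoom (m j) n * (real k / real n - a j)))
            / (\<Sum>k\<in>window (a j) \<delta> n. rel_weight ms (An n) (Bn n) (a j) n k)"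
          unfolding \<mu>_def
          by (rule conditional_expectation_eq[OF X_prob X_meas X_distr _ _ _ _ E])
            (use elim sub pos in auto)
        also have "\<dots> = (\<integral>x. ?W n x * \<phi> (?\<xi> n x) \<partial>lborel) / (\<integral>x. ?W n x \<partial>lborel)"
          using int[of \<phi>] int[of "\<lambda>_. 1"] z by simp
        finally show "\<mu> n \<phi> = (\<integral>x. ?W n x * \<phi> (?\<xi> n x) \<partial>lborel) / (\<integral>x. ?W n x \<partial>lborel)" .
      qed
    qed
    \<comment> \<open>The cell width is bounded by the first summand of the rate.\<close>
    have \<xi>: "\<forall>\<^sub>F n in sequentially. \<forall>x. \<bar>?\<xi> n x - x\<bar> \<le> rate (m j) ms n"
      using ev1 by eventually_elim (use atom_close[OF mj(1)] rate_ge order_trans in blast)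
    have r: "rate (m j) ms n \<ge> 0" for n by (simp add: rate_def zoom_def)
    obtain K where K: "distributed (N j) lborel (Y j) (\<lambda>x. ennreal (K * f x))"
      unfolding f_def using Y_distr[OF j] by blast
    have f: "f x > 0" for x by (simp add: f_def)
    note law = distributed_const_mult_integral[OF Y_prob[OF j] K f]
    have fm: "f \<in> borel_measurable lborel" unfolding f_def by measurable
    note lim = step_expectation_limit[OF fm D(2) law(1)[of "\<lambda>_. 0"] D(1) r rate_tendsto_0[OF mj] D(3) \<xi> \<mu>]
    show "\<exists>C. \<forall>\<^sub>F n in sequentially.
          \<bar>\<integral>\<omega>. \<bar>zoom (m j) n * (real (X n \<omega>) / real n - a j)\<bar> ^ l \<partial>uniform_measure (M n) (E j n)\<bar> \<le> C"
      using lim(1)[of l] by (simp add: \<mu>_def)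
    obtain C where C: "\<forall>\<^sub>F n in sequentially. \<forall>\<phi>. (\<forall>x y. \<bar>\<phi> x - \<phi> y\<bar> \<le> \<bar>x - y\<bar>) \<longrightarrow>
      \<bar>\<mu> n \<phi> - (\<integral>x. f x * \<phi> x \<partial>lborel) / (\<integral>x. f x \<partial>lborel)\<bar> \<le> C * rate (m j) ms n"
      using lim(2) by auto
    have "\<forall>\<^sub>F n in sequentially.
            wasserstein (cond_law (M n) (E j n) (\<lambda>\<omega>. zoom (m j) n * (real (X n \<omega>) / real n - a j))) (distr (N j) borel (Y j))
            \<le> ennreal (\<bar>C\<bar> * rate (m j) ms n)"
      using C ev1
    proof eventually_elim
      case (elim n)
      have Xm: "(\<lambda>\<omega>. zoom (m j) n * (real (X n \<omega>) / real n - a j)) \<in> measurable (uniform_measure (M n) (E j n)) borel"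
      proof -
        have "(\<lambda>\<omega>. zoom (m j) n * (real (X n \<omega>) / real n - a j)) \<in> measurable (M n) borel"
          by (rule measurable_compose[OF X_meas[OF elim(2)]]) simp
        then show ?thesis by (simp cong: measurable_cong_sets)
      qed
      show ?case
        unfolding wasserstein_def
      proof (rule SUP_least)
        fix h assume h: "h \<in> wasserstein_tests"
        have lip: "\<forall>x y. \<bar>h x - h y\<bar> \<le> \<bar>x - y\<bar>" using wasserstein_tests_lipschitz[OF h] by blast
        then have hm: "h \<in> borel_measurable borel" by (intro Lipschitz_1_borel_measurable) auto
        have "(\<integral>x. h x \<partial>cond_law (M n) (E j n) (\<lambda>\<omega>. zoom (m j) n * (real (X n \<omega>) / real n - a j))) = \<mu> n h"
          unfolding cond_law_def \<mu>_def by (rule integral_distr[OF Xm hm])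
        moreover have "\<bar>\<mu> n h - (\<integral>x. f x * h x \<partial>lborel) / (\<integral>x. f x \<partial>lborel)\<bar> \<le> \<bar>C\<bar> * rate (m j) ms n"
          using elim(1)[rule_format, of h] lip mult_right_mono[OF abs_ge_self[of C] r[of n]] by force
        ultimately show "ennreal \<bar>(\<integral>x. h x \<partial>cond_law (M n) (E j n) (\<lambda>\<omega>. zoom (m j) n * (real (X n \<omega>) / real n - a j)))
            - (\<integral>x. h x \<partial>distr (N j) borel (Y j))\<bar> \<le> ennreal (\<bar>C\<bar> * rate (m j) ms n)"
          using law(2)[OF hm] by (intro ennreal_leI) simp
      qed
    qed
    then show "\<exists>C\<ge>0. \<forall>\<^sub>F n in sequentially.
            wasserstein (cond_law (M n) (E j n) (\<lambda>\<omega>. zoom (m j) n * (real (X n \<omega>) / real n - a j))) (distr (N j) borel (Y j))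
            \<le> ennreal (C * rate (m j) ms n)" by (intro exI[of _ "\<bar>C\<bar>"] conjI abs_ge_zero)
  qed
  show ?thesis
  proof (intro conjI ballI allI impI)
    fix j and l :: nat assume j: "j \<in> J"
    obtain C where "\<forall>\<^sub>F n in sequentially.
          \<bar>\<integral>\<omega>. \<bar>zoom (m j) n * (real (X n \<omega>) / real n - a j)\<bar> ^ l \<partial>uniform_measure (M n) (E j n)\<bar> \<le> C"
      using bounds[OF j] by blast
    moreover have "\<forall>\<^sub>F n::nat in sequentially. n \<ge> 1" by (rule eventually_ge_at_top)
    ultimately have "\<forall>\<^sub>F n in sequentially.
        norm (\<integral>\<omega>. \<bar>real (X n \<omega>) / real n - a j\<bar> ^ l \<partial>uniform_measure (M n) (E j n))
        \<le> C * norm (real n powr (- real l / (2 * real (m j))))"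
    proof eventually_elim
      case (elim n)
      let ?m = "\<integral>\<omega>. \<bar>real (X n \<omega>) / real n - a j\<bar> ^ l \<partial>uniform_measure (M n) (E j n)"
      have z: "zoom (m j) n \<ge> 1" using zoom_properties(1)[OF m[OF j] elim(2)] .
      have zl: "real n powr (- real l / (2 * real (m j))) = 1 / zoom (m j) n ^ l"
        using elim(2) by (simp add: zoom_def powr_power powr_minus_divide)
      \<comment> \<open>Homogeneity: a bounded moment in the rescaled coordinate is the claimed
        order in the original one. Dividing by the zoom factor requires n \<ge> 1, as it is 0 at n =
        0.\<close>
      have "(\<integral>\<omega>. \<bar>zoom (m j) n * (real (X n \<omega>) / real n - a j)\<bar> ^ l \<partial>uniform_measure (M n) (E j n)) = zoom (m j) n ^ l * ?m"
        using z by (simp add: abs_mult power_mult_distrib)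
      with elim(1) have "\<bar>zoom (m j) n ^ l * ?m\<bar> \<le> C" by metis
      then have "\<bar>?m\<bar> \<le> C * (1 / zoom (m j) n ^ l)"
        using z by (simp add: abs_mult pos_le_divide_eq mult.commute)
      then show ?case unfolding zl using z by simp
    qed
    then show "(\<lambda>n. \<integral>\<omega>. \<bar>real (X n \<omega>) / real n - a j\<bar> ^ l \<partial>uniform_measure (M n) (E j n))
        \<in> O(\<lambda>n. real n powr (- real l / (2 * real (m j))))" by (rule bigoI)
  next
    fix j assume j: "j \<in> J"
    obtain C where C: "\<forall>\<^sub>F n in sequentially.
            wasserstein (cond_law (M n) (E j n) (\<lambda>\<omega>. zoom (m j) n * (real (X n \<omega>) / real n - a j))) (distr (N j) borel (Y j))
            \<le> ennreal (C * rate (m j) ms n)"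
      using wass[OF j] by blast
    have eq: "C * rate (m j) ms n = C * real n powr (- 1 / (2 * real (m j)))
                + C * real n powr (1 / (2 * real ms) - 1 / (2 * real (m j))) * (if m j \<noteq> ms then 1 else 0)" for n
      by (simp add: rate_def zoom_def powr_minus_divide powr_diff algebra_simps)
    show "\<exists>C1 C2. \<forall>\<^sub>F n in sequentially.
            wasserstein
              (cond_law (M n) (E j n)
                (\<lambda>\<omega>. real n powr (1 / (2 * real (m j))) * (real (X n \<omega>) / real n - a j)))
              (distr (N j) borel (Y j))
            \<le> ennreal (C1 * real n powr (- 1 / (2 * real (m j)))
                + C2 * real n powr (1 / (2 * real ms) - 1 / (2 * real (m j)))
                    * (if m j \<noteq> ms then 1 else 0))"
      using C[unfolded eq, unfolded zoom_def] by (intro exI)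
  qed
qed

end
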